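(* Let $d\geq 1$ be an integer. For any $d$ masses $\mu_1,\ldots,\mu_d$ on $\mathbb{C}^d$ and any integer $q\geq 2$, there exists a collection of regular $q$-sectors $\{\mathcal{S}_{q,\lambda}\}_{\lambda\in S^1}$ centered about a complex hyperplane in $\mathbb{C}^d$ such that $$\left\|\mu_j(\mathcal{S}_{q,\lambda})-\frac{\mu_j(\mathbb{C}^d)}{q}\right\|_2\leq\sqrt{\frac13-\frac{2}{\pi^2}-\frac{1}{3q^2}}\;\mu_j(\mathbb{C}^d)$$ for each $1\leq j\leq d$.
   Context: A mass on $\mathbb{C}^d$ (identified with $\mathbb{R}^{2d}$) is a finite measure that is absolutely continuous with respect to Lebesgue measure. $S^1$ denotes the unit complex numbers, and $d\lambda$ is the normalized (total mass $1$) rotation-invariant measure on $S^1$. The norm $\|\cdot\|_2$ is the $L^2$-norm of functions of $\lambda\in S^1$ with respect to $d\lambda$: $\|f(\lambda)\|_2=\left(\int_{S^1}|f(\lambda)|^2\,d\lambda\right)^{1/2}$. A complex hyperplane in $\mathbb{C}^d$ is a complex affine subspace of complex codimension $1$ (a point if $d=1$); it can be written as $H_{\mathbb{C}}=\{\mathbf{u}\in\mathbb{C}^d\mid \langle \mathbf{u},\mathbf{a}\rangle_{\mathbb{C}}+\bar b=0\}$ with $\mathbf{a}\in\mathbb{C}^d\setminus\{\mathbf{0}\}$, $b\in\mathbb{C}$, $\|\mathbf{a}\|^2+|b|^2=1$, where $\langle\mathbf{u},\mathbf{a}\rangle_{\mathbb{C}}=\sum_{i=1}^d u_i\bar a_i$.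 A complex regular $q$-fan centered about $H_{\mathbb{C}}$ is the union of $q$ half-hyperplanes (halves of real hyperplanes) with common boundary $H_{\mathbb{C}}$ whose successive dihedral angles all equal $2\pi/q$; the resulting closed regions are called regular $q$-sectors. The regular $q$-sectors of all complex regular $q$-fans centered about $H_{\mathbb{C}}$ are parametrized by $\lambda\in S^1$ as $$\mathcal{S}_{q,\lambda}=\{\mathbf{u}\in\mathbb{C}^d\mid \langle\mathbf{u},\mathbf{a}\rangle_{\mathbb{C}}+\bar b=\lambda v \text{ for some } v\in\mathbb{C} \text{ with } v=0 \text{ or } |\arg v|\leq \pi/q\}.$$ Replacing $(\mathbf{a},b)$ by another unit vector defining the same hyperplane only replaces this family by a rotated parametrization $\lambda\mapsto\lambda\lambda_0$ with $\lambda_0 \in S^1$, so the $L^2$-norm above depends only on $H_{\mathbb{C}}$. *)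

theory Defs
  imports "HOL-Analysis.Analysis" "HOL-Probability.Probability"
begin

text \<open>\<open>lborel\<close> on \<open>complex ^ 'd\<close> is the Lebesgue measure of the underlying real
  Euclidean space of dimension \<open>2 * CARD('d)\<close>.  Masses are taken as Borel measures; by absolute
  continuity they have a unique extension to the Lebesgue measurable sets.\<close>

definition mass :: "(complex ^ 'd::finite) measure \<Rightarrow> bool" where
  "mass M \<longleftrightarrow> finite_measure M \<and> sets M = sets borel \<and> absolutely_continuous lborel M"

text \<open>The library's inner product on \<open>complex ^ 'd\<close> is the real one, hence:\<close>

definition cdot :: "complex ^ 'd::finite \<Rightarrow> complex ^ 'd \<Rightarrow> complex" where
  "cdot u a = (\<Sum>i\<in>UNIV. u $ i * cnj (a $ i))"

text \<open>\<open>vec.subspace\<close> and \<open>vec.dim\<close> are taken over the scalar field \<open>complex\<close>.\<close>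

definition complex_hyperplane :: "(complex ^ 'd::finite) set \<Rightarrow> bool" where
  "complex_hyperplane H \<longleftrightarrow>
     (\<exists>p W. vec.subspace W \<and> vec.dim W + 1 = CARD('d) \<and> H = (\<lambda>w. p + w) ` W)"

definition unit_equation :: "complex ^ 'd::finite \<Rightarrow> complex \<Rightarrow> (complex ^ 'd) set \<Rightarrow> bool" where
  "unit_equation a b H \<longleftrightarrow>
     a \<noteq> 0 \<and> (norm a)\<^sup>2 + (cmod b)\<^sup>2 = 1 \<and> H = {u. cdot u a + cnj b = 0}"

definition regular_sector ::
    "nat \<Rightarrow> complex ^ 'd::finite \<Rightarrow> complex \<Rightarrow> complex \<Rightarrow> (complex ^ 'd) set" where
  "regular_sector q a b l =
     {u. \<exists>v. cdot u a + cnj b = l * v \<and> (v = 0 \<or> \<bar>Arg v\<bar> \<le> pi / real q)}"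

definition circle_measure :: "complex measure" where
  "circle_measure =
     distr (uniform_measure lborel {0..2 * pi}) (restrict_space borel (sphere 0 1)) cis"

text \<open>The Bochner integral is \<open>0\<close> for non-integrable integrands; lemma
  \<open>integrable_sector_deviation\<close> below shows that this does not happen where the norm is used.\<close>

definition circle_L2_norm :: "(complex \<Rightarrow> real) \<Rightarrow> real" where
  "circle_L2_norm f = sqrt (LINT l|circle_measure. \<bar>f l\<bar>\<^sup>2)"

lemma space_circle_measure: "space circle_measure = sphere 0 1"
  by (simp add: circle_measure_def space_restrict_space)

lemma sets_circle_measure: "sets circle_measure = sets (restrict_space borel (sphere 0 1))"
  by (simp add: circle_measure_def)

lemma cis_measurable_circle:
  "cis \<in> measurable (uniform_measure lborel {0..2 * pi}) (restrict_space borel (sphere 0 1))"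
proof (rule measurable_restrict_space2)
  show "cis \<in> borel_measurable (uniform_measure lborel {0..2 * pi})"
    using borel_measurable_continuous_onI[of cis] by (simp add: continuous_on_cis cong: measurable_cong_sets)
qed auto

lemma prob_space_circle_measure: "prob_space circle_measure"
  unfolding circle_measure_def
  by (intro prob_space.prob_space_distr cis_measurable_circle prob_space_uniform_measure)
     (simp_all add: emeasure_lborel_Icc)

lemma cone_eq:
  assumes "q \<ge> 1"
  shows "{v. v = 0 \<or> \<bar>Arg v\<bar> \<le> pi / real q} = {v. cmod v * cos (pi / real q) \<le> Re v}"
proof (rule set_eqI, simp)
  fix v :: complex
  have q: "pi / real q \<le> pi" "0 \<le> pi / real q" using assms by (auto simp: divide_le_eq)
  show "(v = 0 \<or> \<bar>Arg v\<bar> \<le> pi / real q) = (cmod v * cos (pi / real q) \<le> Re v)"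
  proof (cases "v = 0")
    case False
    have A: "\<bar>Arg v\<bar> \<le> pi" using Arg_bounded[of v] by auto
    have "\<bar>Arg v\<bar> \<le> pi / real q \<longleftrightarrow> cos (pi / real q) \<le> cos \<bar>Arg v\<bar>"
      by (rule cos_mono_le_eq[symmetric]) (use A q in auto)
    also have "cos \<bar>Arg v\<bar> = cos (Arg v)" by (simp add: abs_if)
    also have "cos (Arg v) = Re v / cmod v"
    proof -
      have "Re v = cmod v * cos (Arg v)"
        using False by (metis Re_rcis rcis_cmod_Arg)
      then show ?thesis using False by simp
    qed
    also have "cos (pi / real q) \<le> Re v / cmod v \<longleftrightarrow> cmod v * cos (pi / real q) \<le> Re v"
      using False by (simp add: le_divide_eq mult.commute)
    finally show ?thesis using False by simp
  qed simp
qed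

lemma regular_sector_eq:
  assumes "q \<ge> 1" "cmod l = 1"
  shows "regular_sector q a b l =
    {u. cmod (cdot u a + cnj b) * cos (pi / real q) \<le> Re (cnj l * (cdot u a + cnj b))}"
proof -
  have l: "l * cnj l = 1" using assms(2) by (simp add: complex_norm_square[symmetric])
  have eq: "w = l * v \<longleftrightarrow> v = cnj l * w" for v w
    using l by (metis mult.assoc mult.commute mult_1)
  have "regular_sector q a b l = {u. cnj l * (cdot u a + cnj b) \<in> {v. v = 0 \<or> \<bar>Arg v\<bar> \<le> pi / real q}}"
    unfolding regular_sector_def eq by blast
  also have "\<dots> = {u. cmod (cdot u a + cnj b) * cos (pi / real q) \<le> Re (cnj l * (cdot u a + cnj b))}"
    unfolding cone_eq[OF assms(1)] by (simp add: norm_mult assms(2) del: complex_cnj_mult)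
  finally show ?thesis .
qed

lemma continuous_on_cdot: "continuous_on UNIV (\<lambda>u. cdot u a)"
  unfolding cdot_def by (intro continuous_intros)

lemma closed_regular_sector:
  assumes "q \<ge> 1" "cmod l = 1"
  shows "closed (regular_sector q a b l)"
  unfolding regular_sector_eq[OF assms]
  by (intro closed_Collect_le continuous_intros continuous_on_cdot)

lemma integrable_sector_deviation:
  assumes "q \<ge> 1" "mass M"
  shows "integrable circle_measure (\<lambda>l. \<bar>measure M (regular_sector q a b l) - c\<bar>\<^sup>2)"
proof -
  interpret finite_measure M using assms by (simp add: mass_def)
  interpret circ: prob_space circle_measure by (rule prob_space_circle_measure)
  have sM: "sets M = sets borel" using assms by (simp add: mass_def)
  have spM: "space M = UNIV" using sets_eq_imp_space_eq[OF sM] by simp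
  define X where "X = {(l, u). cmod (cdot u a + cnj b) * cos (pi / real q)
     \<le> Re (cnj l * (cdot u a + cnj b))}"
  have "closed X" unfolding X_def case_prod_unfold
    by (intro closed_Collect_le continuous_intros
        continuous_on_compose2[OF continuous_on_cdot]) auto
  then have "X \<in> sets (borel \<Otimes>\<^sub>M borel)" unfolding borel_prod by (rule borel_closed)
  then have "X \<in> sets (borel \<Otimes>\<^sub>M M)" using sM by (simp cong: sets_pair_measure_cong)
  then have "(\<lambda>l. emeasure M (Pair l -` X)) \<in> borel_measurable borel"
    by (rule measurable_emeasure_Pair)
  then have "(\<lambda>l. measure M (Pair l -` X)) \<in> borel_measurable borel"
    unfolding measure_def by measurable
  then have "(\<lambda>l. measure M (Pair l -` X)) \<in> borel_measurable (restrict_space borel (sphere 0 1))"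
    by (rule measurable_restrict_space1)
  then have m: "(\<lambda>l. measure M (Pair l -` X)) \<in> borel_measurable circle_measure"
    by (simp cong: measurable_cong_sets add: circle_measure_def)
  have eq: "Pair l -` X = regular_sector q a b l" if "l \<in> space circle_measure" for l
    using that by (auto simp: space_circle_measure regular_sector_eq[OF assms(1)] X_def)
  have m2: "(\<lambda>l. measure M (regular_sector q a b l)) \<in> borel_measurable circle_measure"
    using m by (rule measurable_cong[THEN iffD1, rotated]) (simp add: eq)
  show ?thesis
  proof (rule circ.integrable_const_bound[where B = "(measure M (space M) + \<bar>c\<bar>)\<^sup>2"])
    show "AE l in circle_measure. norm (\<bar>measure M (regular_sector q a b l) - c\<bar>\<^sup>2)
        \<le> (measure M (space M) + \<bar>c\<bar>)\<^sup>2"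
    proof (rule AE_I2)
      fix l
      have "measure M (regular_sector q a b l) \<le> measure M (space M)" by (rule bounded_measure)
      then have "\<bar>measure M (regular_sector q a b l) - c\<bar> \<le> measure M (space M) + \<bar>c\<bar>"
        using measure_nonneg[of M "regular_sector q a b l"] by linarith
      then have "\<bar>measure M (regular_sector q a b l) - c\<bar>\<^sup>2 \<le> (measure M (space M) + \<bar>c\<bar>)\<^sup>2"
        by (rule power_mono) simp
      then show "norm (\<bar>measure M (regular_sector q a b l) - c\<bar>\<^sup>2) \<le> (measure M (space M) + \<bar>c\<bar>)\<^sup>2"
        by simp
    qed
    show "(\<lambda>l. \<bar>measure M (regular_sector q a b l) - c\<bar>\<^sup>2) \<in> borel_measurable circle_measure"
      using m2 by measurable
  qed
qed

end

theory Submission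
  imports Defs
begin

text \<open>
  Fix a hyperplane with equation \<open>level a b u = 0\<close>, where \<open>level a b u = cdot u a + cnj b\<close>. Which of the
  rotated sectors contain a point \<open>u\<close> off the hyperplane depends only on the direction \<open>sgn (level a b u)\<close> on the unit circle,
  so that the mass of the sector at \<open>l\<close> is the mass of an arc of half-width \<open>pi / q\<close> around \<open>l\<close> for
  the distribution of these directions. The idea is to choose the hyperplane such that the first Fourier
  coefficient of every function \<open>l \<mapsto> \<mu> j (S l)\<close> vanishes. This coefficient is a multiple of the
  mean direction, the integral of \<open>sgn (level a b u)\<close> with respect to \<open>\<mu> j\<close>.

  Such a hyperplane exists for topological reasons. The \<open>d\<close> conjugate mean directions form a map from the
  unit sphere of all \<open>(a, b)\<close> in \<open>\<complex>\<^sup>d \<times> \<complex>\<close> to \<open>\<complex>\<^sup>d\<close>.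
  It is continuous, because hyperplanes are null sets, and it commutes with multiplication by unit scalars.
  So it has a zero by a Borsuk-Ulam theorem for the circle group
  (\<open>circle_equivariant_map_has_zero\<close>). That theorem rests on the fact that any two equivariant
  self-maps of the unit sphere of \<open>\<complex>\<^sup>d\<close> are homotopic (\<open>equivariant_maps_homotopic\<close>), which is
  proved by extending equivariant homotopies coordinate by coordinate; a zero-free equivariant map would
  restrict to a null-homotopic one, although the sphere is not contractible.

  For the estimate, the squared \<open>L\<^sup>2\<close>-norm is the double integral of the overlap of two arcs minus \<open>1 / q\<^sup>2\<close>
  (\<open>circle_variance_le\<close>). Once the first harmonic is removed from the overlap, as the vanishing mean
  permits, the remainder is largest when the arcs coincide. With \<open>s = 1 / q\<close> this gives the constant
  \<open>s - s\<^sup>2 - 2 (sin (pi s))\<^sup>2 / pi\<^sup>2\<close>, which is bounded by the one claimed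
  (\<open>sector_constant_le\<close>), with equality for \<open>q = 2\<close>.
\<close>

section \<open>Equivariant maps between spheres\<close>

definition coordinate_subspace :: "'d set \<Rightarrow> (complex ^ 'd::finite) set" where
  "coordinate_subspace A = {x. \<forall>i. i \<notin> A \<longrightarrow> x $ i = 0}"

lemma norm_smult: "norm (l *s x) = cmod l * norm x" for x :: "complex ^ 'd::finite"
  by (simp add: norm_vec_def norm_mult L2_set_right_distrib[symmetric])

lemma continuous_on_smult [continuous_intros]:
  fixes f :: "'a::topological_space \<Rightarrow> complex ^ 'd::finite"
  assumes "continuous_on S c" "continuous_on S f"
  shows "continuous_on S (\<lambda>x. c x *s f x)"
  unfolding vector_scalar_mult_def
  by (intro continuous_on_vec_lambda continuous_intros assms)

lemma continuous_on_axis [continuous_intros]: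
  fixes c :: "'a::topological_space \<Rightarrow> complex"
  assumes "continuous_on S c"
  shows "continuous_on S (\<lambda>x. axis i (c x) :: complex ^ 'd::finite)"
  unfolding axis_def
proof (rule continuous_on_vec_lambda)
  show "continuous_on S (\<lambda>x. if j = i then c x else 0)" for j
    by (cases "j = i") (auto intro: assms)
qed

lemma norm_add_axis:
  fixes y :: "complex ^ 'd::finite"
  assumes "y $ i = 0"
  shows "(norm (y + axis i c))\<^sup>2 = (norm y)\<^sup>2 + (cmod c)\<^sup>2"
proof -
  have "inner y (axis i c) = 0"
    using assms by (simp add: inner_axis)
  moreover have "norm (axis i c :: complex ^ 'd) = cmod c"
    by (simp add: norm_eq_sqrt_inner inner_axis_axis)
  ultimately show ?thesis
    by (simp add: norm_add_Pythagorean orthogonal_def)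
qed

lemma subspace_coordinate_subspace: "subspace (coordinate_subspace A)"
  by (auto simp: coordinate_subspace_def subspace_def)

lemma closed_coordinate_subspace: "closed (coordinate_subspace A)"
  by (simp add: closed_subspace subspace_coordinate_subspace)

lemma dim_times_coordinate_subspace:
  fixes A :: "'d::finite set"
  shows "dim ((UNIV :: real set) \<times> coordinate_subspace A) \<le> 2 * card A + 1"
proof -
  have C: "dim (coordinate_subspace A) \<le> 2 * card A"
  proof -
    define B where "B = (\<lambda>(i, c::complex). axis i c :: complex ^ 'd) ` (A \<times> {1, \<i>})"
    have "x \<in> span B" if x: "x \<in> coordinate_subspace A" for x
    proof -
      have "x = (\<Sum>i\<in>A. axis i (x $ i))"
        using x by (auto simp: vec_eq_iff axis_def coordinate_subspace_def)
      also have "\<dots> = (\<Sum>i\<in>A. Re (x $ i) *\<^sub>R axis i 1 + Im (x $ i) *\<^sub>R axis i \<i>)"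
        by (intro sum.cong refl) (auto simp: vec_eq_iff axis_def complex_eq_iff)
      also have "\<dots> \<in> span B"
        by (intro span_sum span_add span_scale span_base) (auto simp: B_def)
      finally show ?thesis .
    qed
    then have "dim (coordinate_subspace A) \<le> card B"
      by (intro dim_le_card) (auto simp: B_def)
    also have "card B \<le> card (A \<times> {1, \<i>})"
      unfolding B_def by (intro card_image_le) auto
    also have "\<dots> = 2 * card A"
      by (simp add: card_cartesian_product complex_eq_iff)
    finally show ?thesis .
  qed
  have "dim ((UNIV :: real set) \<times> coordinate_subspace A) = dim (UNIV :: real set) + dim (coordinate_subspace A)"
    by (intro dim_Times subspace_UNIV subspace_coordinate_subspace)
  then show ?thesis using C by simp
qed

text \<open>
  The cylinder over the unit ball of the subspace has real dimension \<open>2 * card A + 1\<close>, which is at most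
  \<open>2 * CARD('d) - 1\<close>, the dimension of the target sphere. Below or at the dimension of the sphere
  there is no obstruction to extending a map into it from any closed set; a polytope of the same
  dimension containing the cylinder brings this into the range of the extension theorem for cell complexes.
\<close>

lemma extend_to_cylinder:
  fixes \<phi> :: "real \<times> (complex ^ 'd) \<Rightarrow> complex ^ 'd::finite"
  assumes card: "card A < CARD('d)"
    and Q: "closed Q" "Q \<subseteq> {0..1} \<times> (cball 0 1 \<inter> coordinate_subspace A)"
    and \<phi>: "continuous_on Q \<phi>" "\<phi> ` Q \<subseteq> sphere 0 1"
  obtains k where "continuous_on ({0..1} \<times> (cball 0 1 \<inter> coordinate_subspace A)) k"
    "k ` ({0..1} \<times> (cball 0 1 \<inter> coordinate_subspace A)) \<subseteq> sphere 0 1"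
    "\<And>p. p \<in> Q \<Longrightarrow> k p = \<phi> p"
proof -
  define P where "P = {0..1::real} \<times> (cball 0 1 \<inter> coordinate_subspace A)"
  define L where "L = (UNIV :: real set) \<times> coordinate_subspace A"
  have subL: "subspace L"
    unfolding L_def by (intro subspace_Times subspace_UNIV subspace_coordinate_subspace)
  have "bounded P"
    unfolding P_def by (intro bounded_Times bounded_Int) auto
  then obtain c where c: "P \<subseteq> cbox (-c) c"
    using bounded_subset_cbox_symmetric by blast
  define X where "X = cbox (-c) c \<inter> L"
  have PX: "P \<subseteq> X"
    using c by (auto simp: X_def L_def P_def)
  have polyX: "polytope X"
    unfolding X_def using polytope_Int_polyhedron[OF polytope_interval, of L]
      affine_imp_polyhedron[OF subspace_imp_affine[OF subL]] by blast
  have "aff_dim X \<le> aff_dim L"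
    by (intro aff_dim_subset) (auto simp: X_def)
  also have "\<dots> = int (dim L)"
    by (simp add: aff_dim_subspace subL)
  also have "\<dots> \<le> 2 * int (card A) + 1"
    using dim_times_coordinate_subspace[of A] unfolding L_def by linarith
  also have "\<dots> < 2 * int CARD('d)"
    using card by linarith
  also have "\<dots> = aff_dim (cball (0 :: complex ^ 'd) 1)"
    by (simp add: aff_dim_cball)
  finally have aff: "aff_dim X < aff_dim (cball (0 :: complex ^ 'd) 1)" .
  have rf: "rel_frontier (cball (0 :: complex ^ 'd) 1) = sphere 0 1"
    by simp
  obtain k where k: "continuous_on (\<Union>{X}) k" "k \<in> \<Union>{X} \<rightarrow> rel_frontier (cball (0 :: complex ^ 'd) 1)"
      "\<And>p. p \<in> Q \<Longrightarrow> k p = \<phi> p"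
  proof (rule extend_map_cell_complex_to_sphere[of "{X}" Q "cball (0 :: complex ^ 'd) 1" \<phi>])
    show "Q \<subseteq> \<Union>{X}" using Q(2) PX by (auto simp: P_def)
    show "\<phi> \<in> Q \<rightarrow> rel_frontier (cball (0 :: complex ^ 'd) 1)" using \<phi>(2) rf by auto
    show "polytope Y" if "Y \<in> {X}" for Y using that polyX by simp
    show "aff_dim Y < aff_dim (cball (0 :: complex ^ 'd) 1)" if "Y \<in> {X}" for Y using that aff by simp
    show "Y \<inter> Z face_of Y" if "Y \<in> {X}" "Z \<in> {X}" for Y Z
      using that polytope_imp_convex[OF polyX] by (simp add: face_of_refl)
  qed (use Q \<phi> in auto)
  show ?thesis
  proof (rule that[of k])
    show "continuous_on ({0..1} \<times> (cball 0 1 \<inter> coordinate_subspace A)) k"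
      using k(1) PX continuous_on_subset by (fastforce simp: P_def)
    show "k ` ({0..1} \<times> (cball 0 1 \<inter> coordinate_subspace A)) \<subseteq> sphere 0 1"
      using k(2) PX unfolding rf P_def by blast
  qed (use k in auto)
qed

text \<open>
  A continuous map on a compact set is a quotient map onto its Hausdorff image, so continuity may be
  checked upstairs.
\<close>

lemma continuous_on_image_descend:
  fixes m :: "'a::t2_space \<Rightarrow> 'b::t2_space" and f :: "'b \<Rightarrow> 'c::topological_space"
  assumes "compact K" "continuous_on K m" "continuous_on K (\<lambda>x. f (m x))"
  shows "continuous_on (m ` K) f"
  unfolding continuous_on_closed_invariant
proof (intro allI impI)
  fix B :: "'c set" assume "closed B"
  then obtain A where A: "closed A" "A \<inter> K = (\<lambda>x. f (m x)) -` B \<inter> K"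
    using assms(3) unfolding continuous_on_closed_invariant by blast
  have "compact (m ` (A \<inter> K))"
    using assms A(1) by (intro compact_continuous_image) (auto intro: continuous_on_subset closed_Int_compact)
  then have "closed (m ` (A \<inter> K))"
    by (rule compact_imp_closed)
  moreover have "m ` (A \<inter> K) \<inter> m ` K = f -` B \<inter> m ` K"
    unfolding A(2) by auto
  ultimately show "\<exists>A. closed A \<and> A \<inter> m ` K = f -` B \<inter> m ` K" by blast
qed

definition circle_equivariant_on :: "(complex ^ 'd) set \<Rightarrow> (complex ^ 'd \<Rightarrow> complex ^ 'd::finite) \<Rightarrow> bool" where
  "circle_equivariant_on S f \<longleftrightarrow> (\<forall>x\<in>S. \<forall>l. cmod l = 1 \<longrightarrow> f (l *s x) = l *s f x)"

text \<open>
  One inductive step of equivariant obstruction theory. Write \<open>S\<close> and \<open>S'\<close> for the unit spheres of the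
  coordinate subspaces given by \<open>A\<close> and \<open>insert i A\<close>. The circle acts freely on the points of \<open>S'\<close> outside
  \<open>S\<close>, and each orbit there meets the open hemisphere \<open>x $ i > 0\<close> exactly once. That hemisphere is the
  interior of the ball \<open>D\<close>, embedded by \<open>e\<close>. Hence an equivariant map on \<open>{0..1} \<times> S'\<close> is the same thing
  as a map on \<open>{0..1} \<times> D\<close> that is equivariant over the boundary \<open>S\<close> of \<open>D\<close>: prescribing it there by
  \<open>h\<close>, and by \<open>f\<close> and \<open>g\<close> on the two ends, leaves a plain extension problem for the cylinder, which
  is unobstructed for dimension reasons.
\<close>

lemma equivariant_homotopy_step:
  fixes f g :: "complex ^ 'd \<Rightarrow> complex ^ 'd::finite"
    and h :: "real \<times> (complex ^ 'd) \<Rightarrow> complex ^ 'd"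
  assumes i: "i \<notin> A"
  defines "S \<equiv> sphere 0 1 \<inter> coordinate_subspace A"
    and "S' \<equiv> sphere 0 1 \<inter> coordinate_subspace (insert i A)"
  assumes f: "continuous_on S' f" "f ` S' \<subseteq> sphere 0 1" "circle_equivariant_on S' f"
    and g: "continuous_on S' g" "g ` S' \<subseteq> sphere 0 1" "circle_equivariant_on S' g"
    and h: "continuous_on ({0..1} \<times> S) h" "h ` ({0..1} \<times> S) \<subseteq> sphere 0 1"
      "\<And>t. t \<in> {0..1} \<Longrightarrow> circle_equivariant_on S (\<lambda>x. h (t, x))"
      "\<And>x. x \<in> S \<Longrightarrow> h (0, x) = f x" "\<And>x. x \<in> S \<Longrightarrow> h (1, x) = g x"
  obtains h' where "continuous_on ({0..1::real} \<times> S') h'" "h' ` ({0..1} \<times> S') \<subseteq> sphere 0 1"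
      "\<And>t. t \<in> {0..1} \<Longrightarrow> circle_equivariant_on S' (\<lambda>x. h' (t, x))"
      "\<And>x. x \<in> S' \<Longrightarrow> h' (0, x) = f x" "\<And>x. x \<in> S' \<Longrightarrow> h' (1, x) = g x"
proof -
  define D where "D = cball 0 1 \<inter> (coordinate_subspace A :: (complex ^ 'd) set)"
  define P where "P = {0..1::real} \<times> D"
  define e where "e y = y + axis i (complex_of_real (sqrt (1 - (norm y)\<^sup>2)))" for y :: "complex ^ 'd"
  have closD: "closed D"
    unfolding D_def by (intro closed_Int closed_cball closed_coordinate_subspace)
  have compD: "compact D"
    unfolding D_def by (intro compact_Int_closed compact_cball closed_coordinate_subspace)
  have cont_e: "continuous_on U e" for U
    unfolding e_def by (intro continuous_intros)
  have yi: "y $ i = 0" if "y \<in> D" for y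
    using that i by (auto simp: D_def coordinate_subspace_def)
  have ei: "e y $ i = complex_of_real (sqrt (1 - (norm y)\<^sup>2))" if "y \<in> D" for y
    using yi[OF that] by (simp add: e_def)
  have e_boundary: "e y = y" if "norm y = 1" for y
    using that by (auto simp: e_def vec_eq_iff axis_def)
  have eS': "e y \<in> S'" if y: "y \<in> D" for y
  proof -
    have "norm y \<le> 1" using y by (simp add: D_def)
    then have "(norm y)\<^sup>2 \<le> 1" by (simp add: power_le_one)
    then have "(norm (e y))\<^sup>2 = 1"
      unfolding e_def norm_add_axis[OF yi[OF y]] by simp
    then have "norm (e y) = 1" by (simp add: power2_eq_1_iff) (smt (verit) norm_ge_zero)
    moreover have "e y \<in> coordinate_subspace (insert i A)"
      using y by (auto simp: e_def D_def coordinate_subspace_def axis_def)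
    ultimately show ?thesis by (simp add: S'_def)
  qed
  have DS: "y \<in> S" if "y \<in> D" "norm y = 1" for y
    using that by (simp add: S_def D_def)
  have SS': "S \<subseteq> S'"
    by (auto simp: S_def S'_def coordinate_subspace_def)
  have smult_S': "l *s x \<in> S'" if "x \<in> S'" "cmod l = 1" for l x
    using that by (simp add: S'_def norm_smult coordinate_subspace_def)

  \<comment> \<open>The prescribed data \<open>\<phi>\<close> on the side and on the two ends of the cylinder.\<close>
  define Q1 where "Q1 = {0..1::real} \<times> S"
  define Q2 where "Q2 = {0::real} \<times> D"
  define Q3 where "Q3 = {1::real} \<times> D"
  define \<phi> where "\<phi> p = (if norm (snd p) = 1 then h p else if fst p = 0 then f (e (snd p)) else g (e (snd p)))"
    for p :: "real \<times> (complex ^ 'd)"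
  have S_alt: "S = {y \<in> D. norm y = 1}"
    by (auto simp: S_def D_def)
  have closS: "closed S"
    unfolding S_def by (intro closed_Int closed_sphere closed_coordinate_subspace)
  have c1: "continuous_on Q1 \<phi>"
    using h(1) unfolding Q1_def
    by (rule continuous_on_eq) (auto simp: \<phi>_def S_alt)
  have c2: "continuous_on Q2 \<phi>"
  proof (rule continuous_on_eq[where f = "\<lambda>p. f (e (snd p))"])
    show "continuous_on Q2 (\<lambda>p. f (e (snd p)))"
      by (rule continuous_on_compose2[OF f(1)])
         (auto intro!: continuous_intros continuous_on_compose2[OF cont_e[of UNIV]] eS' simp: Q2_def)
    show "f (e (snd p)) = \<phi> p" if "p \<in> Q2" for p
      using that h(4) by (auto simp: Q2_def \<phi>_def e_boundary DS)
  qed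
  have c3: "continuous_on Q3 \<phi>"
  proof (rule continuous_on_eq[where f = "\<lambda>p. g (e (snd p))"])
    show "continuous_on Q3 (\<lambda>p. g (e (snd p)))"
      by (rule continuous_on_compose2[OF g(1)])
         (auto intro!: continuous_intros continuous_on_compose2[OF cont_e[of UNIV]] eS' simp: Q3_def)
    show "g (e (snd p)) = \<phi> p" if "p \<in> Q3" for p
      using that h(5) by (auto simp: Q3_def \<phi>_def e_boundary DS)
  qed
  have clos: "closed Q1" "closed Q2" "closed Q3"
    unfolding Q1_def Q2_def Q3_def using closD closS by (auto intro!: closed_Times)
  define Q where "Q = Q1 \<union> Q2 \<union> Q3"
  have cont_\<phi>: "continuous_on Q \<phi>"
    unfolding Q_def by (intro continuous_on_closed_Un closed_Un clos c1 c2 c3)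
  have im_\<phi>: "\<phi> ` Q \<subseteq> sphere 0 1"
    using h(2) f(2) g(2) eS' DS
    by (fastforce simp: Q_def Q1_def Q2_def Q3_def \<phi>_def S_alt image_subset_iff)
  have card: "card A < CARD('d)"
    using i by (intro psubset_card_mono) auto
  obtain k where k: "continuous_on P k" "k ` P \<subseteq> sphere 0 1" "\<And>p. p \<in> Q \<Longrightarrow> k p = \<phi> p"
    unfolding P_def D_def
  proof (rule extend_to_cylinder[OF card _ _ cont_\<phi> im_\<phi>])
    show "closed Q" unfolding Q_def by (intro closed_Un clos)
    show "Q \<subseteq> {0..1} \<times> (cball 0 1 \<inter> coordinate_subspace A)"
      by (auto simp: Q_def Q1_def Q2_def Q3_def D_def S_def)
  qed blast
  have k_h: "k (t, y) = h (t, y)" if "t \<in> {0..1}" "y \<in> S" for t y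
    using that k(3)[of "(t, y)"] by (simp add: Q_def Q1_def \<phi>_def S_alt)
  have k_f: "k (0, y) = f (e y)" if "y \<in> D" for y
    using that k(3)[of "(0, y)"] h(4) DS by (simp add: Q_def Q2_def \<phi>_def e_boundary)
  have k_g: "k (1, y) = g (e y)" if "y \<in> D" for y
    using that k(3)[of "(1, y)"] h(5) DS by (simp add: Q_def Q3_def \<phi>_def e_boundary)

  \<comment> \<open>Spread \<open>k\<close> over \<open>S'\<close> by rotation: \<open>m\<close> is the quotient map from the circle times the cylinder.\<close>
  define m where "m = (\<lambda>(l::complex, t::real, y::complex ^ 'd). (t, l *s e y))"
  define K where "K = sphere (0::complex) 1 \<times> P"
  \<comment> \<open>Where \<open>x $ i = 0\<close> the direction of \<open>x $ i\<close> is undefined, but such a point lies in \<open>S\<close>, where \<open>h\<close> itself applies.\<close>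
  define h' where "h' = (\<lambda>(t, x). if x $ i = 0 then h (t, x)
     else sgn (x $ i) *s k (t, cnj (sgn (x $ i)) *s (x - axis i (x $ i))))"
  have compK: "compact K"
    unfolding K_def P_def by (intro compact_Times compact_sphere compact_Icc compD)
  have mem_m: "m p \<in> {0..1} \<times> S'" if "p \<in> K" for p
    using that by (auto simp: m_def K_def P_def intro!: smult_S' eS')
  have surj: "\<exists>l y. cmod l = 1 \<and> y \<in> D \<and> x = l *s e y" if x: "x \<in> S'" for x
  proof -
    define l where "l = (if x $ i = 0 then 1 else sgn (x $ i))"
    define z where "z = x - axis i (x $ i)"
    have l: "cmod l = 1" by (simp add: l_def norm_sgn)
    then have ll: "l * cnj l = 1" by (simp add: complex_norm_square[symmetric])
    have zi: "z $ i = 0" by (simp add: z_def)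
    have "(norm (z + axis i (x $ i)))\<^sup>2 = 1"
      using x by (simp add: z_def S'_def)
    then have nz: "(norm z)\<^sup>2 = 1 - (cmod (x $ i))\<^sup>2"
      unfolding norm_add_axis[OF zi] by linarith
    have ny: "norm (cnj l *s z) = norm z"
      using l by (simp add: norm_smult)
    have "norm z \<le> 1" using nz by (smt (verit) power2_le_imp_le one_power2 zero_le_power2)
    moreover have "z \<in> coordinate_subspace A"
      using x by (auto simp: S'_def z_def coordinate_subspace_def axis_def)
    ultimately have "cnj l *s z \<in> D"
      by (simp add: D_def ny coordinate_subspace_def)
    moreover have "x = l *s e (cnj l *s z)"
    proof -
      have "l *s e (cnj l *s z) = z + axis i (l * complex_of_real (cmod (x $ i)))"
        unfolding e_def ny nz
        by (simp add: vector_add_ldistrib vector_smult_assoc ll) (simp add: vec_eq_iff axis_def)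
      also have "l * complex_of_real (cmod (x $ i)) = x $ i"
        by (simp add: l_def sgn_eq)
      finally show ?thesis by (simp add: z_def)
    qed
    ultimately show ?thesis using l by blast
  qed
  have img: "m ` K = {0..1} \<times> S'"
  proof (intro equalityI subsetI)
    fix p assume "p \<in> {0..1::real} \<times> S'"
    then obtain t :: real and x where p: "p = (t, x)" "t \<in> {0..1}" "x \<in> S'" by auto
    then obtain l y where "cmod l = 1" "y \<in> D" "x = l *s e y" using surj by blast
    then have "p = m (l, t, y)" "(l, t, y) \<in> K"
      using p by (auto simp: m_def K_def P_def)
    then show "p \<in> m ` K" by blast
  qed (use mem_m in blast)
  have h'm: "h' (t, l *s e y) = l *s k (t, y)" if "cmod l = 1" "t \<in> {0..1}" "y \<in> D" for l t y
  proof (cases "norm y = 1")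
    case True
    then have y: "y \<in> S" using that DS by blast
    have "h' (t, l *s e y) = h (t, l *s y)"
      using yi[OF that(3)] by (simp add: h'_def e_boundary True)
    also have "\<dots> = l *s h (t, y)"
      using h(3)[OF that(2)] y that(1) by (simp add: circle_equivariant_on_def)
    finally show ?thesis using k_h that(2) y by simp
  next
    case False
    define r where "r = sqrt (1 - (norm y)\<^sup>2)"
    have "norm y < 1" using that(3) False by (simp add: D_def)
    then have r: "r > 0" by (simp add: r_def power_less_one_iff abs_square_less_1)
    have ey: "e y = y + axis i (complex_of_real r)" by (simp add: e_def r_def)
    have xi: "(l *s e y) $ i = l * complex_of_real r"
      using ei[OF that(3)] by (simp add: r_def)
    have l0: "l \<noteq> 0" using that(1) by auto
    have s: "sgn (l * complex_of_real r) = l"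
      using r that(1) by (simp add: sgn_eq norm_mult)
    have ll: "cnj l * l = 1" using that(1) by (simp add: complex_norm_square[symmetric] mult.commute)
    have "cnj l *s (l *s e y - axis i (l * complex_of_real r)) = y"
      unfolding ey by (simp add: vec_eq_iff axis_def algebra_simps) (use ll in \<open>simp add: mult.commute\<close>)
    then show ?thesis
      using r l0 unfolding h'_def by (simp add: xi s del: vector_smult_component)
  qed
  have cont_h': "continuous_on (m ` K) h'"
  proof (rule continuous_on_image_descend[OF compK])
    show "continuous_on K m"
      unfolding m_def case_prod_unfold
      by (intro continuous_intros continuous_on_compose2[OF cont_e[of UNIV]]) auto
    have "continuous_on K (\<lambda>p. fst p *s k (snd p))"
      by (intro continuous_intros continuous_on_compose2[OF k(1)]) (auto simp: K_def)
    then show "continuous_on K (\<lambda>p. h' (m p))"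
      by (rule continuous_on_eq) (auto simp: K_def P_def m_def h'm)
  qed
  show ?thesis
  proof (rule that[of h'])
    show "continuous_on ({0..1} \<times> S') h'"
      using cont_h' by (simp add: img)
    show "h' ` ({0..1} \<times> S') \<subseteq> sphere 0 1"
    proof clarify
      fix t x assume t: "t \<in> {0..1::real}" and x: "x \<in> S'"
      obtain l y where ly: "cmod l = 1" "y \<in> D" "x = l *s e y" using surj x by blast
      have "k (t, y) \<in> sphere 0 1" using k(2) t ly(2) by (auto simp: P_def image_subset_iff)
      then show "h' (t, x) \<in> sphere 0 1"
        using h'm t ly by (simp add: norm_smult)
    qed
    show "circle_equivariant_on S' (\<lambda>x. h' (t, x))" if t: "t \<in> {0..1}" for t
      unfolding circle_equivariant_on_def
    proof (intro ballI allI impI)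
      fix x l assume x: "x \<in> S'" and l: "cmod l = 1"
      obtain l' y where ly: "cmod l' = 1" "y \<in> D" "x = l' *s e y" using surj x by blast
      have "h' (t, (l * l') *s e y) = (l * l') *s k (t, y)"
        by (rule h'm) (use l ly t in \<open>auto simp: norm_mult\<close>)
      then show "h' (t, l *s x) = l *s h' (t, x)"
        using h'm[OF ly(1) t ly(2)] by (simp add: ly(3) vector_smult_assoc)
    qed
    show "h' (0, x) = f x" if x: "x \<in> S'" for x
    proof -
      obtain l y where ly: "cmod l = 1" "y \<in> D" "x = l *s e y" using surj x by blast
      then show ?thesis
        using h'm[of l 0 y] k_f f(3) eS' by (simp add: circle_equivariant_on_def)
    qed
    show "h' (1, x) = g x" if x: "x \<in> S'" for x
    proof -
      obtain l y where ly: "cmod l = 1" "y \<in> D" "x = l *s e y" using surj x by blast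
      then show ?thesis
        using h'm[of l 1 y] k_g g(3) eS' by (simp add: circle_equivariant_on_def)
    qed
  qed
qed

text \<open>
  By induction on the number of coordinates: enlarging the subspace by one coordinate is
  \<open>equivariant_homotopy_step\<close>. The subspace is a subset of the coordinates of the target, which
  is what keeps every extension problem below the critical dimension.
\<close>

lemma equivariant_maps_homotopic:
  fixes f g :: "complex ^ 'd \<Rightarrow> complex ^ 'd::finite"
  assumes "continuous_on (sphere 0 1 \<inter> coordinate_subspace A) f"
      "f ` (sphere 0 1 \<inter> coordinate_subspace A) \<subseteq> sphere 0 1"
      "circle_equivariant_on (sphere 0 1 \<inter> coordinate_subspace A) f"
    and "continuous_on (sphere 0 1 \<inter> coordinate_subspace A) g"
      "g ` (sphere 0 1 \<inter> coordinate_subspace A) \<subseteq> sphere 0 1"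
      "circle_equivariant_on (sphere 0 1 \<inter> coordinate_subspace A) g"
  shows "\<exists>h. continuous_on ({0..1} \<times> (sphere 0 1 \<inter> coordinate_subspace A)) h \<and>
      h ` ({0..1} \<times> (sphere 0 1 \<inter> coordinate_subspace A)) \<subseteq> sphere 0 1 \<and>
      (\<forall>t\<in>{0..1}. circle_equivariant_on (sphere 0 1 \<inter> coordinate_subspace A) (\<lambda>x. h (t, x))) \<and>
      (\<forall>x\<in>sphere 0 1 \<inter> coordinate_subspace A. h (0, x) = f x \<and> h (1::real, x) = g x)"
proof -
  have "finite A" by simp
  then show ?thesis
    using assms
  proof (induction A rule: finite_induct)
    case empty
    have "sphere 0 1 \<inter> coordinate_subspace {} = ({} :: (complex ^ 'd) set)"
      by (auto simp: coordinate_subspace_def) (metis norm_zero vec_eq_iff zero_index zero_neq_one)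
    then show ?case by (simp add: circle_equivariant_on_def)
  next
    case (insert i A)
    let ?S = "sphere 0 1 \<inter> coordinate_subspace A :: (complex ^ 'd) set"
    let ?S' = "sphere 0 1 \<inter> coordinate_subspace (insert i A) :: (complex ^ 'd) set"
    have sub: "?S \<subseteq> ?S'"
      by (auto simp: coordinate_subspace_def)
    have eq: "circle_equivariant_on ?S u" if "circle_equivariant_on ?S' u" for u :: "complex ^ 'd \<Rightarrow> complex ^ 'd"
      using that sub unfolding circle_equivariant_on_def by blast
    obtain h where h: "continuous_on ({0..1} \<times> ?S) h" "h ` ({0..1} \<times> ?S) \<subseteq> sphere 0 1"
        "\<And>t. t \<in> {0..1} \<Longrightarrow> circle_equivariant_on ?S (\<lambda>x. h (t, x))"
        "\<And>x. x \<in> ?S \<Longrightarrow> h (0, x) = f x" "\<And>x. x \<in> ?S \<Longrightarrow> h (1::real, x) = g x"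
      using insert.IH[OF continuous_on_subset[OF insert.prems(1) sub]
          order_trans[OF image_mono[OF sub] insert.prems(2)] eq[OF insert.prems(3)]
          continuous_on_subset[OF insert.prems(4) sub]
          order_trans[OF image_mono[OF sub] insert.prems(5)] eq[OF insert.prems(6)]]
      by blast
    show ?case
      by (rule equivariant_homotopy_step[OF insert.hyps(2) insert.prems h]) blast+
  qed
qed

lemma homotopic_with_canonI:
  assumes "continuous_on ({0..1::real} \<times> S) h" "h ` ({0..1} \<times> S) \<subseteq> T"
    and "\<And>x. x \<in> S \<Longrightarrow> h (0, x) = f x" "\<And>x. x \<in> S \<Longrightarrow> h (1, x) = g x"
  shows "homotopic_with_canon (\<lambda>_. True) S T f g"
  using assms by (subst homotopic_with) (auto intro!: exI[of _ h] simp: image_subset_iff_funcset)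

text \<open>
  The Borsuk-Ulam theorem for the circle group. A zero-free equivariant map, normalised to \<open>G\<close>, maps the
  unit sphere of \<open>\<complex>\<^sup>d \<times> \<complex>\<close> to that of \<open>\<complex>\<^sup>d\<close>. Restricted to the
  equator \<open>b = 0\<close> it is a circle-equivariant self-map of the sphere, hence homotopic to the identity; but
  moving the equator up the hemisphere \<open>b \<ge> 0\<close> to the pole \<open>(0, 1)\<close> contracts it to a
  constant. The sphere would be contractible.
\<close>

theorem circle_equivariant_map_has_zero:
  fixes F :: "(complex ^ 'd) \<times> complex \<Rightarrow> complex ^ 'd::finite"
  assumes cont: "continuous_on (sphere 0 1) F"
    and equi: "\<And>l a b. cmod l = 1 \<Longrightarrow> norm (a, b) = 1 \<Longrightarrow> F (l *s a, l * b) = l *s F (a, b)"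
  shows "\<exists>x\<in>sphere 0 1. F x = 0"
proof (rule ccontr)
  assume "\<not> ?thesis"
  then have nz: "F x \<noteq> 0" if "norm x = 1" for x
    using that by auto
  define G where "G x = F x /\<^sub>R norm (F x)" for x
  have contG: "continuous_on (sphere 0 1) G"
    unfolding G_def using nz by (intro continuous_intros cont) auto
  have G1: "norm (G x) = 1" if "norm x = 1" for x
    using nz[OF that] by (simp add: G_def)
  have equiG: "G (l *s a, l * b) = l *s G (a, b)" if "cmod l = 1" "norm (a, b) = 1" for l a b
    using that by (simp add: G_def equi norm_smult) (simp add: vec_eq_iff)
  let ?S = "sphere (0 :: complex ^ 'd) 1"
  have top: "?S \<inter> coordinate_subspace UNIV = ?S"
    by (simp add: coordinate_subspace_def)
  have "\<exists>h. continuous_on ({0..1} \<times> ?S) h \<and> h ` ({0..1} \<times> ?S) \<subseteq> ?S \<and>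
      (\<forall>t\<in>{0..1}. circle_equivariant_on ?S (\<lambda>x. h (t, x))) \<and>
      (\<forall>x\<in>?S. h (0, x) = x \<and> h (1::real, x) = G (x, 0))"
  proof (rule equivariant_maps_homotopic[where A = UNIV and f = "\<lambda>x. x" and g = "\<lambda>x. G (x, 0)", unfolded top])
    show "continuous_on ?S (\<lambda>x. G (x, 0))"
      by (intro continuous_on_compose2[OF contG] continuous_intros) (auto simp: norm_Pair)
    show "(\<lambda>x. G (x, 0)) ` ?S \<subseteq> ?S"
      using G1 by (auto simp: norm_Pair)
    show "circle_equivariant_on ?S (\<lambda>x. G (x, 0))"
      using equiG[where b = 0] by (simp add: circle_equivariant_on_def norm_Pair)
  qed (auto simp: circle_equivariant_on_def)
  then have hom1: "homotopic_with_canon (\<lambda>_. True) ?S ?S id (\<lambda>x. G (x, 0))"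
    by (auto intro: homotopic_with_canonI)
  have hom2: "homotopic_with_canon (\<lambda>_. True) ?S ?S (\<lambda>x. G (x, 0)) (\<lambda>x. G (0, 1))"
  proof -
    have n: "norm (sqrt (1 - t\<^sup>2) *\<^sub>R a, complex_of_real t) = 1" if "t \<in> {0..1}" "norm a = 1" for t and a :: "complex ^ 'd"
    proof -
      have "t\<^sup>2 \<le> 1" using that(1) by (simp add: power_le_one)
      then show ?thesis using that by (simp add: norm_Pair power_mult_distrib)
    qed
    show ?thesis
    proof (rule homotopic_with_canonI)
      show "continuous_on ({0..1} \<times> ?S) (\<lambda>p. G (sqrt (1 - (fst p)\<^sup>2) *\<^sub>R snd p, complex_of_real (fst p)))"
        by (rule continuous_on_compose2[OF contG]) (auto intro!: continuous_intros simp: n)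
    qed (auto simp: G1 n)
  qed
  have "contractible ?S"
    unfolding contractible_def using homotopic_with_trans[OF hom1 hom2] by blast
  then show False by (simp add: contractible_sphere)
qed

section \<open>Trigonometric inequalities\<close>

text \<open>
  The maximum of \<open>(sin x)\<^sup>2 / x\<close> is about \<open>0.725\<close>, attained near \<open>x = 1.17\<close>, and
  \<open>pi / 4\<close> is about \<open>0.785\<close>; so rough estimates suffice. Up to \<open>pi / 4\<close> use
  \<open>sin x \<le> x\<close>; beyond it use the double angle, \<open>2 (sin x)\<^sup>2 = 1 + sin y\<close> with
  \<open>y = 2 * x - pi / 2\<close>, and \<open>sin y \<le> min y 1\<close>.
\<close>

lemma sin_squared_le_linear:
  fixes x :: real
  assumes "0 \<le> x" "x \<le> pi / 2"
  shows "(sin x)\<^sup>2 \<le> pi / 4 * x"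
proof (cases "x \<le> pi / 4")
  case True
  have "(sin x)\<^sup>2 \<le> x\<^sup>2"
    using assms sin_x_le_x[of x] sin_ge_zero[of x] by (intro power_mono) auto
  also have "\<dots> \<le> pi / 4 * x"
    using True assms(1) unfolding power2_eq_square by (rule mult_right_mono)
  finally show ?thesis .
next
  case False
  define y where "y = 2 * x - pi / 2"
  have y: "0 \<le> y" using False by (simp add: y_def)
  have pi: "2 \<le> pi\<^sup>2 / 8 + pi / 4"
  proof -
    have "3.14 \<le> pi" using pi_approx by simp
    then have "3.14 * 3.14 \<le> pi * pi" by (intro mult_mono) auto
    then show ?thesis using \<open>3.14 \<le> pi\<close> by (simp add: power2_eq_square)
  qed
  have "sin y - pi / 4 * y \<le> 1 - pi / 4"
  proof (cases "y \<le> 1")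
    case True
    have "(1 - pi / 4) * y \<le> (1 - pi / 4) * 1"
      using True pi_less_4 by (intro mult_left_mono) auto
    then show ?thesis using sin_x_le_x[OF y] by (simp add: algebra_simps)
  next
    case False
    then have "pi / 4 * 1 \<le> pi / 4 * y" by (intro mult_left_mono) auto
    then show ?thesis using sin_le_one[of y] by linarith
  qed
  moreover have "(sin x)\<^sup>2 = (1 + sin y) / 2"
    unfolding y_def sin_diff using cos_double_sin[of x] by simp
  moreover have "pi / 4 * x = (pi / 4 * y + pi\<^sup>2 / 8) / 2"
    by (simp add: y_def power2_eq_square field_simps)
  moreover have "(1 + sin y) / 2 \<le> (pi / 4 * y + pi\<^sup>2 / 8) / 2"
    using pi calculation(1) by (intro divide_right_mono) auto
  ultimately show ?thesis by simp
qed

text \<open>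
  With \<open>s = 1 / q\<close> the claim reads \<open>2 (cos (pi s))\<^sup>2 / pi\<^sup>2 \<le> (1 - s) (1 - 2 s) / 3\<close>, an equality
  for \<open>s = 1 / 2\<close>. For \<open>q \<le> 4\<close>, close to that point, the substitution \<open>t = 1 / 2 - s\<close> and
  \<open>sin (pi t) \<le> pi t\<close> are sharp enough. For larger \<open>q\<close> a constant bound on the squared cosine does it:
  \<open>3 / 4\<close> for \<open>q = 5\<close> and \<open>q = 6\<close>, and \<open>1\<close> from \<open>q = 7\<close> on.
\<close>

lemma sector_constant_le:
  fixes q :: nat
  assumes q: "q \<ge> 2"
  shows "1 / real q - 1 / (real q)\<^sup>2 - 2 * (sin (pi / real q))\<^sup>2 / pi\<^sup>2
    \<le> 1 / 3 - 2 / pi\<^sup>2 - 1 / (3 * (real q)\<^sup>2)"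
proof -
  define s where "s = 1 / real q"
  define t where "t = 1 / 2 - s"
  have s: "0 < s" "s \<le> 1 / 2" using q by (auto simp: s_def field_simps)
  have t: "0 \<le> t" using s by (simp add: t_def)
  have co: "cos (pi * s) = sin (pi * t)"
    by (simp add: t_def sin_diff right_diff_distrib)
  \<comment> \<open>\<open>9.8596 = 3.14\<^sup>2\<close>\<close>
  have pi2: "9.8596 \<le> pi\<^sup>2"
  proof -
    have "3.14 \<le> pi" using pi_approx by simp
    then have "3.14 * 3.14 \<le> pi * pi" by (intro mult_mono) auto
    then show ?thesis by (simp add: power2_eq_square)
  qed
  have key: "2 * (cos (pi * s))\<^sup>2 / pi\<^sup>2 \<le> (1 - s) * (1 - 2 * s) / 3"
  proof (cases "q \<le> 4")
    case True
    have "t \<le> 1 / 4" using True q by (auto simp: t_def s_def field_simps)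
    have "(sin (pi * t))\<^sup>2 \<le> (pi * t)\<^sup>2"
      using t sin_x_le_x[of "pi * t"] \<open>t \<le> 1 / 4\<close>
      by (intro power_mono sin_ge_zero) (auto simp: mult_le_cancel_left2)
    then have "2 * (cos (pi * s))\<^sup>2 / pi\<^sup>2 \<le> 2 * t\<^sup>2"
      by (simp add: co field_simps power_mult_distrib)
    also have "\<dots> = t / 3 + 2 * t\<^sup>2 / 3 - t * (1 - 4 * t) / 3"
      by (simp add: field_simps power2_eq_square)
    also have "\<dots> \<le> t / 3 + 2 * t\<^sup>2 / 3"
      using t \<open>t \<le> 1 / 4\<close> by simp
    also have "\<dots> = (1 - s) * (1 - 2 * s) / 3"
      by (simp add: t_def field_simps power2_eq_square)
    finally show ?thesis .
  next
    case False
    have bound: ?thesis if c: "(cos (pi * s))\<^sup>2 \<le> c" "6 * c \<le> 9.8596 * ((1 - s) * (1 - 2 * s))" for c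
    proof -
      have "0 \<le> (1 - s) * (1 - 2 * s)" using s by (intro mult_nonneg_nonneg) auto
      then have "9.8596 * ((1 - s) * (1 - 2 * s)) \<le> pi\<^sup>2 * ((1 - s) * (1 - 2 * s))"
        using pi2 by (intro mult_right_mono) auto
      then have "6 * (cos (pi * s))\<^sup>2 \<le> pi\<^sup>2 * ((1 - s) * (1 - 2 * s))"
        using c by linarith
      then show ?thesis by (simp add: field_simps)
    qed
    show ?thesis
    proof (cases "q \<le> 6")
      case True
      then have "q = 5 \<or> q = 6" using False by auto
      have "1 / 6 \<le> s" using True q by (auto simp: s_def field_simps)
      then have "sin (pi / 6) \<le> sin (pi * s)"
        using s by (intro sin_monotone_2pi_le) (auto simp: field_simps)
      then have "1 / 4 \<le> (sin (pi * s))\<^sup>2"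
        using power_mono[of "1 / 2" "sin (pi * s)" 2] by (simp add: sin_30 power2_eq_square)
      then have "(cos (pi * s))\<^sup>2 \<le> 3 / 4"
        using sin_cos_squared_add[of "pi * s"] by linarith
      then show ?thesis
        by (rule bound) (use \<open>q = 5 \<or> q = 6\<close> in \<open>auto simp: s_def\<close>)
    next
      case False
      then have s7: "s \<le> 1 / 7" by (auto simp: s_def field_simps)
      then have "(6 / 7) * (5 / 7) \<le> (1 - s) * (1 - 2 * s)"
        by (intro mult_mono) auto
      then show ?thesis
        by (intro bound[of 1]) (auto simp: abs_square_le_1)
    qed
  qed
  have "s - s\<^sup>2 - 2 * (sin (pi * s))\<^sup>2 / pi\<^sup>2 = s - s\<^sup>2 - 2 / pi\<^sup>2 + 2 * (cos (pi * s))\<^sup>2 / pi\<^sup>2"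
    by (simp add: sin_squared_eq field_simps)
  also have "\<dots> \<le> s - s\<^sup>2 - 2 / pi\<^sup>2 + (1 - s) * (1 - 2 * s) / 3"
    using key by simp
  also have "\<dots> = 1 / 3 - 2 / pi\<^sup>2 - s\<^sup>2 / 3"
    by (simp add: field_simps power2_eq_square)
  finally show ?thesis by (simp add: s_def power_divide)
qed

text \<open>
  The left-hand side is the normalised length of the overlap of two arcs of half-width \<open>\<alpha>\<close> whose centres
  differ by \<open>\<theta>\<close>. Its Fourier coefficient at \<open>cos \<theta>\<close> is \<open>2 (sin \<alpha>)\<^sup>2 / pi\<^sup>2\<close>. Removing this
  harmonic leaves a positive definite function, which is largest at \<open>\<theta> = 0\<close>: that is the inequality,
  for which two applications of \<open>sin_squared_le_linear\<close> give an elementary proof.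
\<close>

lemma normalised_overlap_le_cosine:
  fixes \<alpha> \<theta> :: real
  assumes \<alpha>: "0 < \<alpha>" "\<alpha> \<le> pi / 2" and \<theta>: "0 \<le> \<theta>" "\<theta> \<le> pi"
  shows "max 0 (2 * \<alpha> - \<theta>) / (2 * pi) \<le> \<alpha> / pi - 2 * (sin \<alpha>)\<^sup>2 / pi\<^sup>2 * (1 - cos \<theta>)"
proof -
  have half: "1 - cos \<theta> = 2 * (sin (\<theta> / 2))\<^sup>2"
    using cos_double_sin[of "\<theta> / 2"] by simp
  have le1: "(sin x)\<^sup>2 \<le> 1" for x :: real
    by (simp add: abs_square_le_1)
  \<comment> \<open>Bound one of the two factors by \<open>1\<close>, the other by \<open>sin_squared_le_linear\<close>.\<close>
  have "(sin \<alpha>)\<^sup>2 * (sin (\<theta> / 2))\<^sup>2 \<le> pi / 4 * min \<alpha> (\<theta> / 2)"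
  proof -
    have "(sin \<alpha>)\<^sup>2 * (sin (\<theta> / 2))\<^sup>2 \<le> (sin \<alpha>)\<^sup>2" "(sin \<alpha>)\<^sup>2 * (sin (\<theta> / 2))\<^sup>2 \<le> (sin (\<theta> / 2))\<^sup>2"
      using le1 by (simp_all add: mult_left_le mult_left_le_one_le)
    moreover have "(sin \<alpha>)\<^sup>2 \<le> pi / 4 * \<alpha>" "(sin (\<theta> / 2))\<^sup>2 \<le> pi / 4 * (\<theta> / 2)"
      using sin_squared_le_linear[of \<alpha>] sin_squared_le_linear[of "\<theta> / 2"] \<alpha> \<theta> by auto
    ultimately show ?thesis by (auto simp: min_def)
  qed
  then have "4 * ((sin \<alpha>)\<^sup>2 * (sin (\<theta> / 2))\<^sup>2) / pi\<^sup>2 \<le> 4 * (pi / 4 * min \<alpha> (\<theta> / 2)) / pi\<^sup>2"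
    by (intro divide_right_mono) auto
  also have "\<dots> = min \<alpha> (\<theta> / 2) / pi"
    by (simp add: power2_eq_square)
  finally have "2 * (sin \<alpha>)\<^sup>2 / pi\<^sup>2 * (1 - cos \<theta>) \<le> min \<alpha> (\<theta> / 2) / pi"
    by (simp add: half mult.assoc)
  moreover have "max 0 (2 * \<alpha> - \<theta>) / (2 * pi) + min \<alpha> (\<theta> / 2) / pi = \<alpha> / pi"
    by (auto simp: max_def min_def field_simps)
  ultimately show ?thesis by linarith
qed

section \<open>Arcs of the circle\<close>

lemma measure_periodic_window:
  fixes E :: "real set"
  assumes E: "E \<in> sets borel" and per: "\<And>t. t + p \<in> E \<longleftrightarrow> t \<in> E"
    and ab: "a \<le> b" "b \<le> a + p"
  shows "measure lborel (E \<inter> {b..<b + p}) = measure lborel (E \<inter> {a..<a + p})"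
proof -
  have fin: "emeasure lborel (E \<inter> {c..<d}) \<noteq> \<infinity>" for c d :: real
  proof -
    have "emeasure lborel (E \<inter> {c..<d}) \<le> emeasure lborel {c..d}" by (intro emeasure_mono) auto
    also have "\<dots> < \<infinity>" by (simp add: emeasure_lborel_Icc_eq)
    finally show ?thesis by simp
  qed
  have eq1: "E \<inter> {a..<a + p} = (E \<inter> {a..<b}) \<union> (E \<inter> {b..<a + p})"
    using ab by auto
  have eq2: "E \<inter> {b..<b + p} = (E \<inter> {b..<a + p}) \<union> (E \<inter> {a + p..<b + p})"
    using ab by auto
  have sh: "measure lborel (E \<inter> {a + p..<b + p}) = measure lborel (E \<inter> {a..<b})"
  proof -
    have "measure lborel (E \<inter> {a..<b}) = measure (distr lborel borel ((+) (-p))) (E \<inter> {a..<b})"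
      by (simp add: lborel_distr_plus)
    also have "\<dots> = measure lborel ((+) (-p) -` (E \<inter> {a..<b}))"
      using E by (subst measure_distr) auto
    also have "(+) (-p) -` (E \<inter> {a..<b}) = E \<inter> {a + p..<b + p}"
    proof (rule set_eqI)
      fix t
      have "- p + t + p = t" by simp
      with per[of "- p + t"] have "- p + t \<in> E \<longleftrightarrow> t \<in> E" by metis
      moreover have "- p + t \<in> {a..<b} \<longleftrightarrow> t \<in> {a + p..<b + p}" by auto
      ultimately show "t \<in> (+) (- p) -` (E \<inter> {a..<b}) \<longleftrightarrow> t \<in> E \<inter> {a + p..<b + p}"
        by (simp only: vimage_eq Int_iff)
    qed
    finally show ?thesis by simp
  qed
  have "measure lborel (E \<inter> {a..<a + p}) = measure lborel (E \<inter> {a..<b}) + measure lborel (E \<inter> {b..<a + p})"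
    unfolding eq1 using E fin by (intro measure_Union) auto
  moreover have "measure lborel (E \<inter> {b..<b + p}) = measure lborel (E \<inter> {b..<a + p}) + measure lborel (E \<inter> {a + p..<b + p})"
    unfolding eq2 using E fin by (intro measure_Union) auto
  ultimately show ?thesis using sh by simp
qed


lemma borel_cos_strip: "{t. c \<le> cos (t - \<phi>)} \<in> sets borel" for c \<phi> :: real
  by (intro borel_closed closed_Collect_le continuous_intros)

text \<open>
  The window of length \<open>2 * pi\<close> centred at \<open>\<phi>\<close>: there the condition that an angle is close to \<open>\<phi>\<close>
  describes a single interval.
\<close>

lemma measure_periodic_recentre:
  fixes E :: "real set"
  assumes E: "E \<in> sets borel" and per: "\<And>t. t + 2 * pi \<in> E \<longleftrightarrow> t \<in> E"
    and \<phi>: "0 \<le> \<phi>" "\<phi> < 2 * pi"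
  shows "measure lborel (E \<inter> {0..2 * pi}) = measure lborel (E \<inter> {\<phi> - pi..<\<phi> + pi})"
proof -
  have "measure lborel (E \<inter> {0..2 * pi}) = measure lborel (E \<inter> {0..<0 + 2 * pi})"
  proof (rule measure_eq_AE)
    have "AE t in lborel. t \<noteq> 2 * pi" by (rule AE_lborel_singleton)
    then show "AE t in lborel. t \<in> E \<inter> {0..2 * pi} \<longleftrightarrow> t \<in> E \<inter> {0..<0 + 2 * pi}"
      by eventually_elim auto
  qed (use E in auto)
  also have "\<dots> = measure lborel (E \<inter> {\<phi> - pi..<\<phi> - pi + 2 * pi})"
  proof (cases "pi \<le> \<phi>")
    case True
    then show ?thesis using \<phi> by (intro measure_periodic_window[OF E per, symmetric]) auto
  next
    case False
    then show ?thesis using \<phi> by (intro measure_periodic_window[OF E per]) auto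
  qed
  finally show ?thesis by (simp add: algebra_simps)
qed

lemma cos_ge_cos_iff:
  fixes \<alpha> s :: real
  assumes "0 \<le> \<alpha>" "\<alpha> \<le> pi" "\<bar>s\<bar> \<le> pi"
  shows "cos \<alpha> \<le> cos s \<longleftrightarrow> \<bar>s\<bar> \<le> \<alpha>"
  using cos_mono_le_eq[of \<alpha> "\<bar>s\<bar>"] assms by simp

lemma measure_arc:
  fixes \<alpha> \<phi> :: real
  assumes \<alpha>: "0 < \<alpha>" "\<alpha> \<le> pi / 2" and \<phi>: "0 \<le> \<phi>" "\<phi> < 2 * pi"
  shows "measure lborel {t \<in> {0..2 * pi}. cos \<alpha> \<le> cos (t - \<phi>)} = 2 * \<alpha>"
proof -
  define E where "E = {t. cos \<alpha> \<le> cos (t - \<phi>)}"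
  have "t + 2 * pi \<in> E \<longleftrightarrow> t \<in> E" for t
    using cos_periodic[of "t - \<phi>"] by (simp add: E_def algebra_simps)
  then have "measure lborel (E \<inter> {0..2 * pi}) = measure lborel (E \<inter> {\<phi> - pi..<\<phi> + pi})"
    using \<phi> by (intro measure_periodic_recentre) (auto simp: E_def borel_cos_strip)
  also have "E \<inter> {\<phi> - pi..<\<phi> + pi} = {\<phi> - \<alpha>..\<phi> + \<alpha>}"
  proof -
    have "t \<in> E \<longleftrightarrow> \<bar>t - \<phi>\<bar> \<le> \<alpha>" if "\<bar>t - \<phi>\<bar> \<le> pi" for t
      using cos_ge_cos_iff[of \<alpha> "t - \<phi>"] \<alpha> that by (simp add: E_def)
    then show ?thesis using \<alpha> pi_gt_zero by (force simp: abs_le_iff)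
  qed
  finally show ?thesis
    using \<alpha> by (simp add: E_def Int_def conj_commute)
qed

text \<open>
  In the window centred at \<open>\<phi>\<close> the two arcs overlap in one interval. They cannot also meet on the far side
  of the circle, since \<open>\<alpha> \<le> pi / 2\<close>; in the extreme case \<open>\<alpha> = pi / 2\<close>, \<open>\<theta> = pi\<close>
  the far side contributes the single point \<open>\<phi> - \<alpha>\<close>, which is null.
\<close>

lemma measure_arc_overlap_le:
  fixes \<alpha> \<phi> \<theta> :: real
  assumes \<alpha>: "0 < \<alpha>" "\<alpha> \<le> pi / 2" and \<phi>: "0 \<le> \<phi>" "\<phi> < 2 * pi" and \<theta>: "0 \<le> \<theta>" "\<theta> \<le> pi"
  shows "measure lborel {t \<in> {0..2 * pi}. cos \<alpha> \<le> cos (t - \<phi>) \<and> cos \<alpha> \<le> cos (t - (\<phi> + \<theta>))}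
    \<le> max 0 (2 * \<alpha> - \<theta>)"
proof -
  define E where "E = {t. cos \<alpha> \<le> cos (t - \<phi>)} \<inter> {t. cos \<alpha> \<le> cos (t - (\<phi> + \<theta>))}"
  have E: "E \<in> sets borel"
    unfolding E_def by (intro sets.Int borel_cos_strip)
  have "t + 2 * pi \<in> E \<longleftrightarrow> t \<in> E" for t
    using cos_periodic[of "t - \<phi>"] cos_periodic[of "t - (\<phi> + \<theta>)"] by (simp add: E_def algebra_simps)
  then have "measure lborel (E \<inter> {0..2 * pi}) = measure lborel (E \<inter> {\<phi> - pi..<\<phi> + pi})"
    using \<phi> E by (intro measure_periodic_recentre)
  also have "\<dots> \<le> measure lborel {\<phi> + \<theta> - \<alpha>..\<phi> + \<alpha>}"
  proof -
    have sub: "t \<in> {\<phi> + \<theta> - \<alpha>..\<phi> + \<alpha>}" if t: "t \<in> E" "\<phi> - pi \<le> t" "t < \<phi> + pi" "t \<noteq> \<phi> - \<alpha>" for t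
    proof -
      have 1: "\<bar>t - \<phi>\<bar> \<le> \<alpha>"
        using cos_ge_cos_iff[of \<alpha> "t - \<phi>"] \<alpha> t by (auto simp: E_def abs_le_iff)
      show ?thesis
      proof (cases "- pi \<le> t - (\<phi> + \<theta>)")
        case True
        then have "\<bar>t - (\<phi> + \<theta>)\<bar> \<le> \<alpha>"
          using cos_ge_cos_iff[of \<alpha> "t - (\<phi> + \<theta>)"] \<alpha> \<theta> t 1 by (auto simp: E_def abs_le_iff)
        then show ?thesis using 1 by auto
      next
        case False
        have "cos (t - (\<phi> + \<theta>) + 2 * pi) \<ge> cos \<alpha>"
          using t(1) cos_periodic[of "t - (\<phi> + \<theta>)"] by (simp add: E_def)
        then have "\<bar>t - (\<phi> + \<theta>) + 2 * pi\<bar> \<le> \<alpha>"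
          using cos_ge_cos_iff[of \<alpha> "t - (\<phi> + \<theta>) + 2 * pi"] \<alpha> \<theta> 1 False by (auto simp: abs_le_iff)
        then have "t = \<phi> - \<alpha>" using 1 \<alpha> \<theta> by auto
        then show ?thesis using t by simp
      qed
    qed
    have "measure lborel (E \<inter> {\<phi> - pi..<\<phi> + pi}) \<le> measure lborel ({\<phi> + \<theta> - \<alpha>..\<phi> + \<alpha>} \<union> {\<phi> - \<alpha>})"
    proof (rule measure_mono_fmeasurable)
      show "{\<phi> + \<theta> - \<alpha>..\<phi> + \<alpha>} \<union> {\<phi> - \<alpha>} \<in> fmeasurable lborel"
        by (intro fmeasurable.Un fmeasurableI) (auto simp: emeasure_lborel_Icc_eq)
    qed (use sub E in \<open>force+\<close>)
    also have "\<dots> \<le> measure lborel {\<phi> + \<theta> - \<alpha>..\<phi> + \<alpha>} + measure lborel {\<phi> - \<alpha>}"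
      by (intro measure_Un_le) auto
    finally show ?thesis by simp
  qed
  also have "\<dots> \<le> max 0 (2 * \<alpha> - \<theta>)"
    by (cases "\<theta> \<le> 2 * \<alpha>") auto
  finally show ?thesis
    by (simp add: E_def Int_def conj_commute conj_assoc conj_left_commute)
qed

lemma measure_circle_Collect:
  assumes "{l. P l} \<in> sets borel"
  shows "measure circle_measure {l \<in> sphere 0 1. P l} = measure lborel {t \<in> {0..2 * pi}. P (cis t)} / (2 * pi)"
proof -
  let ?U = "uniform_measure lborel {0..2 * pi}"
  have "{l \<in> sphere 0 1. P l} \<in> sets (restrict_space borel (sphere 0 1))"
    using assms by (auto simp: sets_restrict_space Int_def image_iff intro!: bexI[of _ "{l. P l}"])
  then have "measure circle_measure {l \<in> sphere 0 1. P l} = measure ?U (cis -` {l \<in> sphere 0 1. P l} \<inter> space ?U)"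
    unfolding circle_measure_def by (rule measure_distr[OF cis_measurable_circle])
  also have "cis -` {l \<in> sphere 0 1. P l} \<inter> space ?U = {t. P (cis t)}"
    by auto
  also have "measure ?U {t. P (cis t)} = measure lborel ({0..2 * pi} \<inter> {t. P (cis t)}) / measure lborel {0..2 * pi}"
  proof (rule measure_uniform_measure)
    have "cis -` {l. P l} \<inter> space borel \<in> sets borel"
      using assms by (intro measurable_sets[of cis borel borel]) (auto intro!: borel_measurable_continuous_onI continuous_intros)
    then show "{t. P (cis t)} \<in> sets lborel" by (simp add: vimage_def)
  qed (auto simp: emeasure_lborel_Icc_eq)
  finally show ?thesis by (simp add: Int_def)
qed

lemma arc_condition_cis: "Re (cnj (cis t) * cis \<phi>) = cos (t - \<phi>)"
  by (simp add: cos_diff)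

lemma borel_arc_condition: "{l. c \<le> Re (cnj l * x)} \<in> sets borel" for c :: real and x :: complex
  by (intro borel_closed closed_Collect_le continuous_intros)

lemma unit_eq_cis:
  assumes "cmod x = 1"
  obtains \<phi> where "0 \<le> \<phi>" "\<phi> < 2 * pi" "x = cis \<phi>"
  using that[of "Arg2pi x"] Arg2pi_ge_0[of x] Arg2pi_lt_2pi[of x] Arg2pi_eq[of x] assms
  by (simp add: cis_conv_exp)

lemma circle_measure_arc:
  assumes "0 < \<alpha>" "\<alpha> \<le> pi / 2" and "cmod x = 1"
  shows "measure circle_measure {l \<in> sphere 0 1. cos \<alpha> \<le> Re (cnj l * x)} = \<alpha> / pi"
proof -
  obtain \<phi> where \<phi>: "0 \<le> \<phi>" "\<phi> < 2 * pi" "x = cis \<phi>"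
    using unit_eq_cis assms(3) by blast
  then show ?thesis
    using measure_circle_Collect[OF borel_arc_condition[of "cos \<alpha>" x]] measure_arc[OF assms(1,2) \<phi>(1,2)]
    unfolding \<phi>(3) arc_condition_cis by simp
qed

lemma circle_measure_overlap_le:
  assumes \<alpha>: "0 < \<alpha>" "\<alpha> \<le> pi / 2" and x: "cmod x = 1" and y: "cmod y = 1"
  shows "measure circle_measure {l \<in> sphere 0 1. cos \<alpha> \<le> Re (cnj l * x) \<and> cos \<alpha> \<le> Re (cnj l * y)}
    \<le> \<alpha> / pi - 2 * (sin \<alpha>)\<^sup>2 / pi\<^sup>2 * (1 - Re (cnj x * y))"
proof -
  \<comment> \<open>By symmetry \<open>y\<close> may be assumed to lie counterclockwise of \<open>x\<close>.\<close>
  have oriented: "measure circle_measure {l \<in> sphere 0 1. cos \<alpha> \<le> Re (cnj l * x) \<and> cos \<alpha> \<le> Re (cnj l * (x * cis \<theta>))}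
    \<le> \<alpha> / pi - 2 * (sin \<alpha>)\<^sup>2 / pi\<^sup>2 * (1 - cos \<theta>)"
    if x: "cmod x = 1" and \<theta>: "0 \<le> \<theta>" "\<theta> \<le> pi" for x \<theta>
  proof -
    obtain \<phi> where \<phi>: "0 \<le> \<phi>" "\<phi> < 2 * pi" "x = cis \<phi>"
      using unit_eq_cis x by blast
    have B: "{l. cos \<alpha> \<le> Re (cnj l * cis \<phi>) \<and> cos \<alpha> \<le> Re (cnj l * cis (\<phi> + \<theta>))} \<in> sets borel"
      using sets.Int[OF borel_arc_condition borel_arc_condition] by (simp only: Int_def mem_Collect_eq)
    have "measure circle_measure {l \<in> sphere 0 1. cos \<alpha> \<le> Re (cnj l * x) \<and> cos \<alpha> \<le> Re (cnj l * (x * cis \<theta>))}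
      = measure lborel {t \<in> {0..2 * pi}. cos \<alpha> \<le> cos (t - \<phi>) \<and> cos \<alpha> \<le> cos (t - (\<phi> + \<theta>))} / (2 * pi)"
      unfolding \<phi>(3) cis_mult using measure_circle_Collect[OF B] by (simp only: arc_condition_cis)
    also have "\<dots> \<le> max 0 (2 * \<alpha> - \<theta>) / (2 * pi)"
      using measure_arc_overlap_le[OF \<alpha> \<phi>(1,2) \<theta>] by (intro divide_right_mono) auto
    also have "\<dots> \<le> \<alpha> / pi - 2 * (sin \<alpha>)\<^sup>2 / pi\<^sup>2 * (1 - cos \<theta>)"
      by (rule normalised_overlap_le_cosine[OF \<alpha> \<theta>])
    finally show ?thesis .
  qed
  have unit: "z * cnj z = 1" if "cmod z = 1" for z
    using that by (simp add: complex_norm_square[symmetric])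
  define \<theta> where "\<theta> = Arg (cnj x * y)"
  have \<theta>: "- pi < \<theta>" "\<theta> \<le> pi" using Arg_bounded[of "cnj x * y"] by (auto simp: \<theta>_def)
  have n: "cmod (cnj x * y) = 1" using x y by (simp add: norm_mult)
  then have "cnj x * y \<noteq> 0" by force
  then have w: "cnj x * y = cis \<theta>"
    unfolding \<theta>_def using cis_Arg[of "cnj x * y"] n by (simp add: sgn_eq)
  then have c: "Re (cnj x * y) = cos \<theta>" by simp
  have y_eq: "y = x * cis \<theta>"
    using w unit[OF x] by (metis mult.assoc mult_1)
  show ?thesis
  proof (cases "0 \<le> \<theta>")
    case True
    then show ?thesis using oriented[OF x True \<theta>(2)] by (simp only: c y_eq[symmetric])
  next
    case False
    have x_eq: "x = y * cis (- \<theta>)"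
      unfolding y_eq by (simp add: mult.assoc cis_mult)
    then show ?thesis
      using oriented[OF y, of "- \<theta>"] False \<theta> by (simp only: c x_eq[symmetric] cos_minus conj_commute)
  qed
qed

section \<open>Variance of the mass of an arc\<close>

lemma measurable_id_circle: "(\<lambda>l. l) \<in> borel_measurable circle_measure"
  using measurable_restrict_space1[OF measurable_ident_sets[OF refl], of borel "sphere 0 1"]
  by (simp add: circle_measure_def cong: measurable_cong_sets)

lemma (in pair_sigma_finite) integral_product_mult:
  fixes f :: "'a \<Rightarrow> 'c::{real_normed_field, banach, second_countable_topology}" and g :: "'b \<Rightarrow> 'c"
  assumes "integrable (M1 \<Otimes>\<^sub>M M2) (\<lambda>(x, y). f x * g y)"
  shows "(LINT p|(M1 \<Otimes>\<^sub>M M2). (case p of (x, y) \<Rightarrow> f x * g y)) = integral\<^sup>L M1 f * integral\<^sup>L M2 g"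
  using integral_fst'[OF assms] by simp

text \<open>
  The circular form of the estimate: \<open>D\<close> is the distribution of directions of the mass around the hyperplane,
  and the normalised arcs have length \<open>s = \<alpha> / pi\<close>. Squaring the deviation and interchanging the integrals
  turns the \<open>L\<^sup>2\<close>-norm into a double integral over \<open>D\<close> of the overlap of arcs centred at \<open>x\<close>
  and \<open>y\<close>, minus \<open>s\<^sup>2\<close>. The overlap is at most \<open>s - c + c Re (cnj x * y)\<close> with
  \<open>c = 2 (sin \<alpha>)\<^sup>2 / pi\<^sup>2\<close>, and the double integral of \<open>Re (cnj x * y)\<close> is the squared modulus of the
  first moment of \<open>D\<close>, which vanishes.
\<close>

lemma circle_variance_le:
  assumes fin: "finite_measure D" and sD: "sets D = sets borel"
    and unit: "AE z in D. cmod z = 1" and mean: "(LINT z|D. z) = 0"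
    and \<alpha>: "0 < \<alpha>" "\<alpha> \<le> pi / 2"
  shows "(LINT l|circle_measure. (measure D {z. cos \<alpha> \<le> Re (cnj l * z)} - \<alpha> / pi * measure D UNIV)\<^sup>2)
    \<le> (\<alpha> / pi - (\<alpha> / pi)\<^sup>2 - 2 * (sin \<alpha>)\<^sup>2 / pi\<^sup>2) * (measure D UNIV)\<^sup>2"
proof -
  interpret D: finite_measure D by fact
  interpret C: prob_space circle_measure by (rule prob_space_circle_measure)
  interpret DD: pair_sigma_finite D D ..
  define P where "P = D \<Otimes>\<^sub>M D"
  interpret P: finite_measure P
    unfolding P_def by (intro finite_measure_pair_measure fin)
  interpret CP: pair_sigma_finite circle_measure P ..
  have spD: "space D = UNIV" using sets_eq_imp_space_eq[OF sD] by simp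
  have [measurable_cong]: "sets D = sets borel" by fact
  define s where "s = \<alpha> / pi"
  define c where "c = 2 * (sin \<alpha>)\<^sup>2 / pi\<^sup>2"
  define m where "m = measure D UNIV"
  \<comment> \<open>The arc condition \<open>Re (cnj l * z) \<ge> cos \<alpha>\<close> in real coordinates, which makes its joint measurability evident; \<open>s\<close> is the average of \<open>A l z\<close> over \<open>l\<close> for unit \<open>z\<close>.\<close>
  define A where "A l z = (if cos \<alpha> \<le> Re l * Re z + Im l * Im z then 1 else 0 :: real)" for l z :: complex
  define p where "p l z = A l z - s" for l z
  have s: "0 \<le> s" "s \<le> 1" using \<alpha> by (auto simp: s_def field_simps)
  have A_eq: "A l z = (if cos \<alpha> \<le> Re (cnj l * z) then 1 else 0)" for l z
    by (simp add: A_def)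
  have A_bound: "\<bar>A l z\<bar> \<le> 1" for l z
    by (simp add: A_def)
  have p_bound: "\<bar>p l z\<bar> \<le> 1" for l z
    using s by (auto simp: p_def A_def)
  have A_meas [measurable]: "(\<lambda>v. A (f v) (g v)) \<in> borel_measurable N"
    if [measurable]: "f \<in> borel_measurable N" "g \<in> borel_measurable N" for f g and N :: "'b measure"
    unfolding A_def by measurable
  have p_meas [measurable]: "(\<lambda>v. p (f v) (g v)) \<in> borel_measurable N"
    if [measurable]: "f \<in> borel_measurable N" "g \<in> borel_measurable N" for f g and N :: "'b measure"
    unfolding p_def by measurable
  have [measurable]: "A l \<in> borel_measurable D" "p l \<in> borel_measurable D" for l
    using A_meas[of "\<lambda>_. l" D "\<lambda>z. z"] p_meas[of "\<lambda>_. l" D "\<lambda>z. z"]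
      measurable_ident_sets[OF sD] by simp_all
  have [measurable]: "(\<lambda>l. A l z) \<in> borel_measurable circle_measure"
      "(\<lambda>l. p l z) \<in> borel_measurable circle_measure" for z
    using A_meas[of "\<lambda>l. l" circle_measure "\<lambda>_. z"] p_meas[of "\<lambda>l. l" circle_measure "\<lambda>_. z"]
      measurable_id_circle by simp_all
  have [measurable]: "fst \<in> borel_measurable (circle_measure \<Otimes>\<^sub>M N)"
      "snd \<in> borel_measurable (N \<Otimes>\<^sub>M circle_measure)" for N :: "'b measure"
    by (rule measurable_compose[OF measurable_fst measurable_id_circle]
        measurable_compose[OF measurable_snd measurable_id_circle])+
  have [measurable]: "cnj \<in> borel_measurable borel"
    by (intro borel_measurable_continuous_onI continuous_intros)
  have p2_bound: "\<bar>p l x * p l y\<bar> \<le> 1" for l x y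
    using mult_mono[OF p_bound p_bound, of l x l y] by (simp add: abs_mult mult.commute)

  have int_A: "integrable D (\<lambda>z. A l z)" for l
    by (rule D.integrable_const_bound[where B = 1]) (simp_all add: A_bound)
  have dev: "measure D {z. cos \<alpha> \<le> Re (cnj l * z)} - s * m = (LINT z|D. p l z)" for l
  proof -
    have "(LINT z|D. A l z) = (LINT z|D. indicator {z. cos \<alpha> \<le> Re (cnj l * z)} z)"
      by (intro Bochner_Integration.integral_cong) (auto simp: A_eq)
    also have "\<dots> = measure D {z. cos \<alpha> \<le> Re (cnj l * z)}"
      by (simp add: spD)
    finally show ?thesis
      unfolding p_def using int_A[of l] by (simp add: spD m_def mult.commute)
  qed
  have sq: "(LINT z|D. p l z)\<^sup>2 = (LINT w|P. p l (fst w) * p l (snd w))" for l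
  proof -
    have "integrable P (\<lambda>(x, y). p l x * p l y)"
      by (rule P.integrable_const_bound[where B = 1]) (auto simp: P_def p2_bound case_prod_unfold)
    then show ?thesis
      unfolding P_def power2_eq_square
      using DD.integral_product_mult[of "p l" "p l"] by (simp add: case_prod_unfold)
  qed
  have unitP: "AE w in P. cmod (fst w) = 1 \<and> cmod (snd w) = 1"
    unfolding P_def
  proof (rule DD.AE_pair_measure)
    show "AE x in D. AE y in D. cmod (fst (x, y)) = 1 \<and> cmod (snd (x, y)) = 1"
      using unit by eventually_elim (use unit in simp)
  qed measurable
  have int_prod: "integrable P (\<lambda>(x, y). cnj x * y)"
  proof (rule P.integrable_const_bound[where B = 1])
    show "AE w in P. norm (case w of (x, y) \<Rightarrow> cnj x * y) \<le> 1"
      using unitP by eventually_elim (auto simp: case_prod_unfold norm_mult)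
    show "(\<lambda>(x, y). cnj x * y) \<in> borel_measurable P"
      unfolding P_def by measurable
  qed
  have int_Re: "integrable P (\<lambda>w. Re (cnj (fst w) * snd w))"
    using integrable_Re[OF int_prod] by (simp only: case_prod_unfold)
  interpret CPp: finite_measure "circle_measure \<Otimes>\<^sub>M P"
    by (intro finite_measure_pair_measure) unfold_locales
  have int_pp: "integrable (circle_measure \<Otimes>\<^sub>M P) (\<lambda>(l, w). p l (fst w) * p l (snd w))"
    by (rule CPp.integrable_const_bound[where B = 1]) (auto simp: p2_bound case_prod_unfold P_def)
  have "(LINT l|circle_measure. (measure D {z. cos \<alpha> \<le> Re (cnj l * z)} - s * m)\<^sup>2)
      = (LINT l|circle_measure. (LINT w|P. p l (fst w) * p l (snd w)))"
    by (simp only: dev sq)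
  also have "\<dots> = (LINT w|P. (LINT l|circle_measure. p l (fst w) * p l (snd w)))"
    using CP.Fubini_integral[OF int_pp] by simp
  also have "\<dots> \<le> (LINT w|P. (s - s\<^sup>2 - c) + c * Re (cnj (fst w) * snd w))"
  proof (rule integral_mono_AE)
    show "integrable P (\<lambda>w. LINT l|circle_measure. p l (fst w) * p l (snd w))"
      by (rule CP.integrable_snd[OF int_pp])
    show "integrable P (\<lambda>w. (s - s\<^sup>2 - c) + c * Re (cnj (fst w) * snd w))"
      by (intro Bochner_Integration.integrable_add integrable_mult_right int_Re) simp
    show "AE w in P. (LINT l|circle_measure. p l (fst w) * p l (snd w)) \<le> (s - s\<^sup>2 - c) + c * Re (cnj (fst w) * snd w)"
      using unitP
    proof eventually_elim
      case (elim w)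
      define x where "x = fst w"
      define y where "y = snd w"
      have xy: "cmod x = 1" "cmod y = 1" using elim by (auto simp: x_def y_def)
      have arcs: "measure circle_measure {l \<in> sphere 0 1. Q l} = (LINT l|circle_measure. (if Q l then 1 else 0))" for Q
      proof -
        have "(LINT l|circle_measure. (if Q l then 1 else 0)) = (LINT l|circle_measure. indicator {l \<in> sphere 0 1. Q l} l)"
          by (intro Bochner_Integration.integral_cong) (auto simp: space_circle_measure)
        also have "\<dots> = measure circle_measure ({l \<in> sphere 0 1. Q l} \<inter> space circle_measure)"
          by simp
        also have "{l \<in> sphere 0 1. Q l} \<inter> space circle_measure = {l \<in> sphere 0 1. Q l}"
          by (auto simp: space_circle_measure)
        finally show ?thesis by simp
      qed
      have int_A: "(LINT l|circle_measure. A l z) = s" if "cmod z = 1" for z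
        using circle_measure_arc[OF \<alpha> that] unfolding arcs A_eq s_def .
      have "(LINT l|circle_measure. A l x * A l y)
          = (LINT l|circle_measure. (if cos \<alpha> \<le> Re (cnj l * x) \<and> cos \<alpha> \<le> Re (cnj l * y) then 1 else 0))"
        by (intro Bochner_Integration.integral_cong) (auto simp: A_eq)
      then have int_AA: "(LINT l|circle_measure. A l x * A l y) \<le> s - c * (1 - Re (cnj x * y))"
        using circle_measure_overlap_le[OF \<alpha> xy] unfolding arcs s_def c_def by simp
      have [simp]: "integrable circle_measure (\<lambda>l. A l z)" "integrable circle_measure (\<lambda>l. A l x * A l y)" for z
        by (rule C.integrable_const_bound[where B = 1]; simp add: A_bound A_bound[THEN mult_mono[OF A_bound], simplified] abs_mult)+
      have "p l x * p l y = A l x * A l y - s * A l x - s * A l y + s\<^sup>2" for l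
        by (simp add: p_def algebra_simps power2_eq_square)
      then have "(LINT l|circle_measure. p l x * p l y) = (LINT l|circle_measure. A l x * A l y) - s\<^sup>2"
        using C.prob_space by (simp add: int_A xy power2_eq_square)
      also have "\<dots> \<le> (s - s\<^sup>2 - c) + c * Re (cnj x * y)"
        using int_AA by (simp add: algebra_simps)
      finally show ?case by (simp add: x_def y_def)
    qed
  qed
  also have "\<dots> = (s - s\<^sup>2 - c) * m\<^sup>2"
  proof -
    have "(LINT w|P. Re (cnj (fst w) * snd w)) = Re (LINT w|P. cnj (fst w) * snd w)"
      using integral_Re[OF int_prod] by (simp only: case_prod_unfold)
    also have "(LINT w|P. cnj (fst w) * snd w) = 0"
      using DD.integral_product_mult[of cnj "\<lambda>z. z"] int_prod mean by (simp add: P_def case_prod_unfold)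
    finally have zero: "(LINT w|P. Re (cnj (fst w) * snd w)) = 0" by simp
    have "integrable P (\<lambda>(x, y). 1 * (1::real))"
      by (simp add: case_prod_unfold)
    then have "measure P (space P) = m * m"
      using DD.integral_product_mult[of "\<lambda>_. 1::real" "\<lambda>_. 1"] by (simp add: P_def m_def spD case_prod_unfold)
    then show ?thesis
      using int_Re zero by (simp add: power2_eq_square del: times_complex.sel)
  qed
  finally show ?thesis by (simp add: s_def c_def m_def)
qed

section \<open>Masses and sectors\<close>

definition level :: "complex ^ 'd \<Rightarrow> complex \<Rightarrow> complex ^ 'd::finite \<Rightarrow> complex" where
  "level a b u = cdot u a + cnj b"

lemma level_smult: "level (l *s a) (l * b) u = cnj l * level a b u"
  by (simp add: level_def cdot_def sum_distrib_left algebra_simps)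

lemma Re_cdot: "Re (cdot u a) = u \<bullet> a"
  by (simp add: cdot_def inner_vec_def inner_complex_def)

lemma level_zero_null:
  fixes a :: "complex ^ 'd::finite"
  assumes M: "mass M" and ab: "(a, b) \<noteq> 0"
  shows "AE u in M. level a b u \<noteq> 0"
proof -
  have clos: "closed {u. level a b u = 0}"
    unfolding level_def by (intro closed_Collect_eq continuous_intros continuous_on_cdot)
  have "{u. level a b u = 0} \<in> null_sets lborel"
  proof (cases "a = 0")
    case True
    then have "{u. level a b u = 0} = {}" using ab by (auto simp: level_def cdot_def zero_prod_def)
    then show ?thesis by simp
  next
    case False
    have "negligible {u. a \<bullet> u = - Re b}"
      using False by (intro negligible_hyperplane) auto
    moreover have "{u. level a b u = 0} \<subseteq> {u. a \<bullet> u = - Re b}"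
    proof clarify
      fix u assume "level a b u = 0"
      then have "Re (level a b u) = 0" by simp
      then show "a \<bullet> u = - Re b" by (simp add: level_def Re_cdot inner_commute)
    qed
    ultimately have "negligible {u. level a b u = 0}"
      by (rule negligible_subset)
    then show ?thesis
      using borel_closed[OF clos] by (simp add: negligible_iff_null_sets null_sets_completion_iff)
  qed
  then have "{u. level a b u = 0} \<in> null_sets M"
    using M by (auto simp: mass_def absolutely_continuous_def)
  then show ?thesis by (auto intro: AE_I')
qed

text \<open>
  The integrand jumps on the hyperplane only, which is null; so dominated convergence applies. This
  includes the degenerate points of the sphere with \<open>a = 0\<close>, where the level is a nonzero constant.
\<close>

lemma continuous_mean_sgn_level:
  fixes M :: "(complex ^ 'd::finite) measure"
  assumes M: "mass M"
  shows "continuous_on (sphere 0 1) (\<lambda>x. LINT u|M. sgn (cnj (level (fst x) (snd x) u)))"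
  unfolding continuous_on_sequentially
proof (intro allI ballI impI)
  fix X :: "nat \<Rightarrow> (complex ^ 'd) \<times> complex" and x
  assume x: "x \<in> sphere 0 1" and X: "(\<forall>n. X n \<in> sphere 0 1) \<and> X \<longlonglongrightarrow> x"
  interpret finite_measure M using M by (simp add: mass_def)
  have sM: "sets M = sets borel" using M by (simp add: mass_def)
  have lev: "isCont (\<lambda>y. level (fst y) (snd y) u) x" for u :: "complex ^ 'd"
    unfolding level_def cdot_def by (intro continuous_intros)
  have meas: "(\<lambda>u. sgn (cnj (level (fst y) (snd y) u))) \<in> borel_measurable M" for y :: "(complex ^ 'd) \<times> complex"
  proof -
    have "(\<lambda>u. cnj (level (fst y) (snd y) u)) \<in> borel_measurable borel"
      unfolding level_def by (intro borel_measurable_continuous_onI continuous_intros continuous_on_cdot)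
    then have "(\<lambda>u. sgn (cnj (level (fst y) (snd y) u))) \<in> borel_measurable borel"
      unfolding sgn_div_norm by measurable
    then show ?thesis using measurable_cong_sets[OF sM refl] by blast
  qed
  have "(\<lambda>n. LINT u|M. sgn (cnj (level (fst (X n)) (snd (X n)) u))) \<longlonglongrightarrow> (LINT u|M. sgn (cnj (level (fst x) (snd x) u)))"
  proof (rule integral_dominated_convergence[where w = "\<lambda>_. 1"])
    have "(fst x, snd x) \<noteq> 0" using x by (auto simp: zero_prod_def)
    then have "AE u in M. level (fst x) (snd x) u \<noteq> 0"
      by (rule level_zero_null[OF M])
    then show "AE u in M. (\<lambda>n. sgn (cnj (level (fst (X n)) (snd (X n)) u))) \<longlonglongrightarrow> sgn (cnj (level (fst x) (snd x) u))"
    proof eventually_elim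
      case (elim u)
      have "(\<lambda>n. level (fst (X n)) (snd (X n)) u) \<longlonglongrightarrow> level (fst x) (snd x) u"
        using isCont_tendsto_compose[OF lev] X by blast
      then show ?case
        using elim by (intro tendsto_sgn tendsto_cnj) auto
    qed
  qed (use meas in \<open>auto simp: norm_sgn\<close>)
  then show "((\<lambda>x. LINT u|M. sgn (cnj (level (fst x) (snd x) u))) \<circ> X) \<longlonglongrightarrow> (LINT u|M. sgn (cnj (level (fst x) (snd x) u)))"
    by (simp add: o_def)
qed

text \<open>
  Away from the hyperplane, membership in a sector depends only on the direction \<open>sgn (level a b u)\<close>. So
  the sector masses are the masses of arcs of half-width \<open>pi / q\<close> under the distribution of this direction.
\<close>

lemma circle_L2_norm_sector_le:
  fixes M :: "(complex ^ 'd::finite) measure"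
  assumes M: "mass M" and q: "q \<ge> 2" and ab: "(a, b) \<noteq> 0"
    and mean: "(LINT u|M. sgn (cnj (level a b u))) = 0"
  shows "circle_L2_norm (\<lambda>l. measure M (regular_sector q a b l) - measure M UNIV / real q)
    \<le> sqrt (1 / 3 - 2 / pi\<^sup>2 - 1 / (3 * (real q)\<^sup>2)) * measure M UNIV"
proof -
  interpret finite_measure M using M by (simp add: mass_def)
  have sM: "sets M = sets borel" using M by (simp add: mass_def)
  have spM: "space M = UNIV" using sets_eq_imp_space_eq[OF sM] by simp
  define \<alpha> where "\<alpha> = pi / real q"
  have \<alpha>: "0 < \<alpha>" "\<alpha> \<le> pi / 2" using q by (auto simp: \<alpha>_def field_simps)
  have \<alpha>q: "\<alpha> / pi = 1 / real q" by (simp add: \<alpha>_def)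
  define d where "d u = sgn (level a b u)" for u
  have d_borel: "d \<in> borel_measurable borel"
  proof -
    have "level a b \<in> borel_measurable borel"
      unfolding level_def by (intro borel_measurable_continuous_onI continuous_intros continuous_on_cdot)
    then show ?thesis unfolding d_def sgn_div_norm by measurable
  qed
  then have d: "d \<in> borel_measurable M" using measurable_cong_sets[OF sM refl] by blast
  define D where "D = distr M borel d"
  have nz: "AE u in M. level a b u \<noteq> 0" by (rule level_zero_null[OF M ab])
  have fin: "finite_measure D" unfolding D_def by (rule finite_measure_distr[OF d])
  have unit: "AE z in D. cmod z = 1"
  proof -
    have "AE u in M. cmod (d u) = 1" using nz by eventually_elim (simp add: d_def norm_sgn)
    then show ?thesis unfolding D_def by (subst AE_distr_iff[OF d]) auto
  qed
  have meanD: "(LINT z|D. z) = 0"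
  proof -
    have "(LINT z|D. z) = (LINT u|M. d u)"
      unfolding D_def by (subst integral_distr[OF d]) auto
    also have "\<dots> = (LINT u|M. cnj (sgn (cnj (level a b u))))"
      by (simp add: d_def sgn_eq)
    also have "\<dots> = 0"
      using mean by (simp add: integral_cnj)
    finally show ?thesis .
  qed
  have mD: "measure D B = measure M (d -` B)" if "B \<in> sets borel" for B
    unfolding D_def using measure_distr[OF d that] by (simp add: spM)
  have massD: "measure D UNIV = measure M UNIV" using mD[of UNIV] by simp
  have sector: "measure M (regular_sector q a b l) = measure D {z. cos \<alpha> \<le> Re (cnj l * z)}"
    if l: "cmod l = 1" for l
  proof -
    have B: "{z. cos \<alpha> \<le> Re (cnj l * z)} \<in> sets borel"
      by (intro borel_closed closed_Collect_le continuous_intros)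
    have "measure M (regular_sector q a b l) = measure M (d -` {z. cos \<alpha> \<le> Re (cnj l * z)})"
    proof (rule measure_eq_AE)
      show "AE u in M. u \<in> regular_sector q a b l \<longleftrightarrow> u \<in> d -` {z. cos \<alpha> \<le> Re (cnj l * z)}"
        using nz
      proof eventually_elim
        case (elim u)
        have "cnj l * level a b u = cmod (level a b u) *\<^sub>R (cnj l * d u)"
          using elim by (simp add: d_def sgn_eq scaleR_conv_of_real)
        then have "Re (cnj l * level a b u) = cmod (level a b u) * Re (cnj l * d u)"
          by (simp only: scaleR_complex.sel)
        moreover have "u \<in> regular_sector q a b l
            \<longleftrightarrow> cmod (level a b u) * cos \<alpha> \<le> Re (cnj l * level a b u)"
          using q l by (simp only: regular_sector_eq level_def \<alpha>_def mem_Collect_eq)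
        ultimately show ?case
          using elim by (simp del: times_complex.sel)
      qed
      show "regular_sector q a b l \<in> sets M"
        using closed_regular_sector[of q l a b] q l by (simp add: sM)
      show "d -` {z. cos \<alpha> \<le> Re (cnj l * z)} \<in> sets M"
        using measurable_sets[OF d B] by (simp add: spM)
    qed
    then show ?thesis using mD[OF B] by simp
  qed
  have "(LINT l|circle_measure. \<bar>measure M (regular_sector q a b l) - measure M UNIV / real q\<bar>\<^sup>2)
      = (LINT l|circle_measure. (measure D {z. cos \<alpha> \<le> Re (cnj l * z)} - \<alpha> / pi * measure D UNIV)\<^sup>2)"
    by (intro Bochner_Integration.integral_cong) (auto simp: space_circle_measure sector massD \<alpha>q)
  also have "\<dots> \<le> (\<alpha> / pi - (\<alpha> / pi)\<^sup>2 - 2 * (sin \<alpha>)\<^sup>2 / pi\<^sup>2) * (measure D UNIV)\<^sup>2"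
    by (rule circle_variance_le[OF fin _ unit meanD \<alpha>]) (simp add: D_def)
  also have "\<dots> \<le> (1 / 3 - 2 / pi\<^sup>2 - 1 / (3 * (real q)\<^sup>2)) * (measure M UNIV)\<^sup>2"
    unfolding massD \<alpha>q using sector_constant_le[OF q]
    by (intro mult_right_mono) (auto simp: \<alpha>_def power_divide)
  finally have "circle_L2_norm (\<lambda>l. measure M (regular_sector q a b l) - measure M UNIV / real q)
      \<le> sqrt ((1 / 3 - 2 / pi\<^sup>2 - 1 / (3 * (real q)\<^sup>2)) * (measure M UNIV)\<^sup>2)"
    unfolding circle_L2_norm_def by (rule real_sqrt_le_mono)
  then show ?thesis by (simp add: real_sqrt_mult)
qed

section \<open>Hyperplanes that annihilate the first harmonic\<close>

text \<open>
  The kernel of \<open>\<lambda>u. cdot u a\<close> has codimension \<open>1\<close>, because adjoining \<open>a\<close> to it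
  spans everything.
\<close>

lemma complex_hyperplane_level:
  fixes a :: "complex ^ 'd::finite"
  assumes a: "a \<noteq> 0"
  shows "complex_hyperplane {u. cdot u a + cnj b = 0}"
proof -
  define W where "W = {u. cdot u a = 0}"
  have add: "cdot (u + v) a = cdot u a + cdot v a" for u v
    by (simp add: cdot_def sum.distrib algebra_simps)
  have scale: "cdot (l *s u) a = l * cdot u a" for l u
    by (simp add: cdot_def sum_distrib_left algebra_simps)
  have aa: "cdot a a \<noteq> 0"
  proof
    assume "cdot a a = 0"
    then have "Re (cdot a a) = 0" by simp
    then show False using a by (simp add: Re_cdot)
  qed
  have sub: "vec.subspace W"
    by (auto simp: vec.subspace_def W_def add scale) (simp add: cdot_def)
  have span_W: "vec.span W = W" using sub by (simp add: vec.span_eq_iff)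
  have "a \<notin> vec.span W"
    unfolding span_W using aa by (simp add: W_def)
  then have "vec.dim (insert a W) = vec.dim W + 1"
    by (simp add: vec.dim_insert)
  moreover have "vec.span (insert a W) = UNIV"
  proof -
    have "u \<in> vec.span (insert a W)" for u
    proof -
      define k where "k = cdot u a / cdot a a"
      have "cdot (u - k *s a) a = cdot u a - k * cdot a a"
        using add[of "u - k *s a" "k *s a"] by (simp add: scale algebra_simps)
      then have "u - k *s a \<in> W" using aa by (simp add: W_def k_def)
      then have "(u - k *s a) + k *s a \<in> vec.span (insert a W)"
        by (intro vec.span_add vec.span_scale vec.span_base) auto
      then show ?thesis by simp
    qed
    then show ?thesis by blast
  qed
  then have "vec.dim (insert a W) = CARD('d)"
    by (metis vec.dim_span vec_dim_card)
  ultimately have dim: "vec.dim W + 1 = CARD('d)" by simp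
  define p where "p = (- cnj b / cdot a a) *s a"
  have p: "cdot p a = - cnj b" unfolding p_def scale using aa by simp
  have "{u. cdot u a + cnj b = 0} = (\<lambda>w. p + w) ` W"
  proof (intro equalityI subsetI)
    fix u assume "u \<in> {u. cdot u a + cnj b = 0}"
    then have "cdot (u - p) a = 0"
      using add[of "u - p" p] p by simp
    then show "u \<in> (\<lambda>w. p + w) ` W"
      by (intro image_eqI[of _ _ "u - p"]) (auto simp: W_def)
  qed (auto simp: W_def add p)
  then show ?thesis
    unfolding complex_hyperplane_def using sub dim by blast
qed

theorem corollary1p2:
  fixes \<mu> :: "nat \<Rightarrow> (complex ^ 'd::finite) measure" and q :: nat
  assumes "\<And>j. j \<in> {1..CARD('d)} \<Longrightarrow> mass (\<mu> j)"
    and "q \<ge> 2"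
  shows "\<exists>H a b. complex_hyperplane H \<and> unit_equation a b H \<and>
           (\<forall>j\<in>{1..CARD('d)}.
              circle_L2_norm
                (\<lambda>l. measure (\<mu> j) (regular_sector q a b l) - measure (\<mu> j) UNIV / real q)
              \<le> sqrt (1 / 3 - 2 / pi\<^sup>2 - 1 / (3 * (real q)\<^sup>2)) * measure (\<mu> j) UNIV)"
proof -
  \<comment> \<open>The circle-equivariant map whose zeros are the hyperplanes sought; \<open>idx\<close> enumerates the masses by coordinates.\<close>
  obtain idx :: "'d \<Rightarrow> nat" where idx: "bij_betw idx UNIV {1..CARD('d)}"
    using finite_same_card_bij[of "UNIV :: 'd set" "{1..CARD('d)}"] by auto
  define F :: "(complex ^ 'd) \<times> complex \<Rightarrow> complex ^ 'd" where
    "F x = (\<chi> i. LINT u|\<mu> (idx i). sgn (cnj (level (fst x) (snd x) u)))" for x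
  have mass: "mass (\<mu> (idx i))" for i
    using assms(1) bij_betwE[OF idx] by auto
  have "\<exists>x\<in>sphere 0 1. F x = 0"
  proof (rule circle_equivariant_map_has_zero)
    show "continuous_on (sphere 0 1) F"
      unfolding F_def by (intro continuous_on_vec_lambda continuous_mean_sgn_level mass)
    show "F (l *s a, l * b) = l *s F (a, b)" if "cmod l = 1" for l a b
      using that by (simp add: F_def vec_eq_iff level_smult sgn_mult sgn_eq[of l])
  qed
  then obtain a b where ab: "norm (a, b) = 1" and zero: "F (a, b) = 0"
    by auto
  have mean: "(LINT u|\<mu> j. sgn (cnj (level a b u))) = 0" if "j \<in> {1..CARD('d)}" for j
  proof -
    have "j \<in> range idx" using idx that by (simp add: bij_betw_def)
    then obtain i where "j = idx i" by blast
    then show ?thesis using arg_cong[OF zero, of "\<lambda>v. v $ i"] by (simp add: F_def)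
  qed
  have result: ?thesis if a': "a' \<noteq> 0" and unit: "norm (a', b') = 1"
    and mean': "\<And>j. j \<in> {1..CARD('d)} \<Longrightarrow> (LINT u|\<mu> j. sgn (cnj (level a' b' u))) = 0" for a' b'
  proof (intro exI conjI ballI)
    show "complex_hyperplane {u. cdot u a' + cnj b' = 0}"
      by (rule complex_hyperplane_level[OF a'])
    show "unit_equation a' b' {u. cdot u a' + cnj b' = 0}"
      using a' unit by (simp add: unit_equation_def norm_Pair)
    show "circle_L2_norm (\<lambda>l. measure (\<mu> j) (regular_sector q a' b' l) - measure (\<mu> j) UNIV / real q)
        \<le> sqrt (1 / 3 - 2 / pi\<^sup>2 - 1 / (3 * (real q)\<^sup>2)) * measure (\<mu> j) UNIV"
      if "j \<in> {1..CARD('d)}" for j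
      by (rule circle_L2_norm_sector_le[OF assms(1)[OF that] assms(2) _ mean'[OF that]])
         (use a' in \<open>simp add: zero_prod_def\<close>)
  qed
  \<comment> \<open>A zero with \<open>a = 0\<close> gives no hyperplane, but then all masses are zero and any hyperplane will do.\<close>
  show ?thesis
  proof (cases "a = 0")
    case False
    then show ?thesis using result[OF False ab mean] by blast
  next
    case True
    have b: "cmod b = 1" using ab True by (simp add: norm_Pair)
    have null: "(LINT u|\<mu> j. f u) = 0" if j: "j \<in> {1..CARD('d)}" for j and f :: "_ \<Rightarrow> complex"
    proof -
      have M: "mass (\<mu> j)" using assms(1) j .
      interpret finite_measure "\<mu> j" using M by (simp add: mass_def)
      have "sgn (cnj (level a b u)) = b" for u
        using True b by (simp add: level_def cdot_def sgn_eq)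
      then have "measure (\<mu> j) (space (\<mu> j)) = 0"
        using mean[OF j] b by auto
      then have "emeasure (\<mu> j) (space (\<mu> j)) = 0"
        by (simp add: emeasure_eq_measure)
      then have "AE u in \<mu> j. f u = 0"
        by (intro AE_I[of _ _ "space (\<mu> j)"]) auto
      then show ?thesis by (rule integral_eq_zero_AE)
    qed
    have "norm (axis undefined 1 :: complex ^ 'd) = 1" by (simp add: norm_eq_sqrt_inner inner_axis_axis)
    then show ?thesis
      using null by (intro result[of "axis undefined 1" 0]) (auto simp: norm_Pair)
  qed
qed

end
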